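(* Let $W=W(x)$ be a matrix weight of size $N$ on an interval $(a,b)$, with support $S$. Then the following conditions are equivalent: (i) $W$ is equivalent to a direct sum of matrix weights of smaller size; (ii) there is an idempotent matrix $Q\in\mathrm{Mat}_N(\mathbb C)$, $Q\neq 0,I$, such that $QW(x)=W(x)Q^*$ for (almost) all $x$; (iii) the real vector space $\mathcal C_{\mathbb R}=\{T\in\mathrm{Mat}_N(\mathbb C): TW(x)=W(x)T^*\ \text{for a.e. } x\in S\}$ properly contains $\mathbb R I$.
   Context: A matrix weight of size $N$ on an interval $(a,b)\subseteq\mathbb R$ (possibly unbounded) is an integrable function $W:(a,b)\to\mathrm{Mat}_N(\mathbb C)$ such that $W(x)$ is (self-adjoint) positive semidefinite for all $x\in(a,b)$, positive definite for almost every $x$, and with finite moments of all orders, i.e. $\int_a^b x^nW(x)\,dx\in\mathrm{Mat}_N(\mathbb C)$ exists for all integers $n\ge 0$. Two matrix weights $W,W'$ of the same size on the same interval are equivalent if there is a nonsingular constant matrix $M$ with $W'(x)=MW(x)M^*$ for all $x$. $W$ is the direct sum $W_1\oplus\cdots\oplus W_j$ of matrix weights (on the same interval) if $W(x)$ is the block diagonal matrix with diagonal blocks $W_1(x),\dots,W_j(x)$. Matrix weights are identified when they agree almost everywhere, so "for all $x$" is understood as "for almost every $x$". $T^*$ denotes the conjugate transpose. *)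

theory Defs
  imports "HOL-Analysis.Analysis" "Jordan_Normal_Form.Schur_Decomposition"
begin

text \<open>The inequalities below are in the order of \<^theory>\<open>HOL-Library.Complex_Order\<close>, so they
  also say that the quadratic form is real.\<close>

definition pos_semidef_mat :: "nat \<Rightarrow> complex mat \<Rightarrow> bool" where
  "pos_semidef_mat n A \<longleftrightarrow> A \<in> carrier_mat n n \<and> mat_adjoint A = A \<and>
     (\<forall>v \<in> carrier_vec n. 0 \<le> (A *\<^sub>v v) \<bullet>c v)"

definition pos_def_mat :: "nat \<Rightarrow> complex mat \<Rightarrow> bool" where
  "pos_def_mat n A \<longleftrightarrow> A \<in> carrier_mat n n \<and> mat_adjoint A = A \<and>
     (\<forall>v \<in> carrier_vec n. v \<noteq> 0\<^sub>v n \<longrightarrow> 0 < (A *\<^sub>v v) \<bullet>c v)"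

text \<open>Matrix-valued integrability is entrywise Lebesgue integrability. The interval endpoints
  are extended reals; the values of \<open>W\<close> outside the interval are irrelevant.\<close>

definition matrix_weight :: "ereal \<Rightarrow> ereal \<Rightarrow> nat \<Rightarrow> (real \<Rightarrow> complex mat) \<Rightarrow> bool" where
  "matrix_weight a b n W \<longleftrightarrow>
     n \<ge> 1 \<and>
     (\<forall>i<n. \<forall>j<n. set_integrable lebesgue (einterval a b) (\<lambda>x. W x $$ (i, j))) \<and>
     (\<forall>x \<in> einterval a b. pos_semidef_mat n (W x)) \<and>
     (AE x in lebesgue. x \<in> einterval a b \<longrightarrow> pos_def_mat n (W x)) \<and>
     (\<forall>k::nat. \<forall>i<n. \<forall>j<n.
        set_integrable lebesgue (einterval a b) (\<lambda>x. of_real (x ^ k) * W x $$ (i, j)))"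

definition weight_equivalent ::
  "ereal \<Rightarrow> ereal \<Rightarrow> nat \<Rightarrow> (real \<Rightarrow> complex mat) \<Rightarrow> (real \<Rightarrow> complex mat) \<Rightarrow> bool" where
  "weight_equivalent a b n W W' \<longleftrightarrow>
     matrix_weight a b n W \<and> matrix_weight a b n W' \<and>
     (\<exists>M \<in> carrier_mat n n. invertible_mat M \<and>
        (AE x in lebesgue. x \<in> einterval a b \<longrightarrow> W' x = M * W x * mat_adjoint M))"

definition direct_sum_weight :: "(real \<Rightarrow> complex mat) list \<Rightarrow> real \<Rightarrow> complex mat" where
  "direct_sum_weight Ws x = diag_block_mat (map (\<lambda>V. V x) Ws)"

text \<open>The support is the topological support, closed relative to the interval on which the weight
  lives.\<close>

definition weight_support :: "ereal \<Rightarrow> ereal \<Rightarrow> nat \<Rightarrow> (real \<Rightarrow> complex mat) \<Rightarrow> real set" where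
  "weight_support a b n W =
     einterval a b \<inter> closure {x \<in> einterval a b. W x \<noteq> 0\<^sub>m n n}"

definition real_commutant :: "nat \<Rightarrow> real set \<Rightarrow> (real \<Rightarrow> complex mat) \<Rightarrow> complex mat set" where
  "real_commutant n S W =
     {T \<in> carrier_mat n n. AE x in lebesgue. x \<in> S \<longrightarrow> T * W x = W x * mat_adjoint T}"

definition real_scalar_mats :: "nat \<Rightarrow> complex mat set" where
  "real_scalar_mats n = {complex_of_real r \<cdot>\<^sub>m 1\<^sub>m n | r. True}"

end

theory Submission
  imports Defs
begin

text \<open>If \<open>T W = W T\<^sup>*\<close> holds almost everywhere, it holds at some point \<open>x\<close> with \<open>W x\<close> positive
  definite. There \<open>T\<close> is self-adjoint for an inner product, hence diagonalizable with real
  eigenvalues, and its spectral projections are real polynomials in \<open>T\<close>, so they intertwine every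
  \<open>W x\<close> with their adjoint as \<open>T\<close> does. A nontrivial idempotent with this property is
  \<open>M\<^sup>-\<^sup>1 diag(I, 0) M\<close> for some invertible \<open>M\<close>, and the property says that \<open>M W M\<^sup>*\<close> commutes
  with \<open>diag(I, 0)\<close>, that is, \<open>M W M\<^sup>*\<close> is block diagonal.\<close>

subsection \<open>Adjoints and congruence\<close>

text \<open>The inner product at \<open>x\<close> enters the spectral argument through one fact
  only: if \<open>X * W x * mat_adjoint X\<close> vanishes, so does \<open>X\<close>. Reality of the
  eigenvalues is the crux, because the adjoint conjugates scalars: \<open>T - e I\<close>
  intertwines a nonzero \<open>W x\<close> with its adjoint only for real \<open>e\<close>. The
  chosen point merely reveals that the roots are real and simple. These are properties of
  \<open>T\<close> alone, so one idempotent serves almost every \<open>x\<close>, although the inner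
  product changes with \<open>x\<close>. The idempotent need not be self-adjoint in the standard
  sense. Hence \<open>M\<close> is only invertible, not unitary, and acts on \<open>W\<close> by
  congruence. A further obstacle is that a weight must be positive semidefinite at every point,
  while block diagonality of \<open>M W M^*\<close> is known only almost everywhere. The summands
  are therefore built from the rows of \<open>M\<close>, which gives weights on the whole interval,
  and are compared with \<open>M W M^*\<close> afterwards.\<close>

lemma mat_adjoint_index [simp]:
  "i < dim_col A \<Longrightarrow> j < dim_row A \<Longrightarrow> mat_adjoint A $$ (i, j) = conjugate (A $$ (j, i))"
  by (simp add: mat_adjoint_def mat_of_rows_def)

lemma mat_adjoint_dim [simp]:
  "dim_row (mat_adjoint A) = dim_col A" "dim_col (mat_adjoint A) = dim_row A"
  by (simp_all add: mat_adjoint_def)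

lemma mat_adjoint_carrier [simp]: "A \<in> carrier_mat m n \<Longrightarrow> mat_adjoint A \<in> carrier_mat n m"
  by (auto intro: carrier_matI)

lemma mat_adjoint_adjoint [simp]: "mat_adjoint (mat_adjoint A) = A"
  by (rule eq_matI) auto

lemma mat_adjoint_mult:
  assumes "A \<in> carrier_mat l m" "B \<in> carrier_mat m n"
  shows "mat_adjoint (A * B) = mat_adjoint B * mat_adjoint A"
  using assms
  by (intro eq_matI)
    (auto simp: scalar_prod_def sum_conjugate conjugate_dist_mul mult.commute intro!: sum.cong)

lemma mat_adjoint_one [simp]: "mat_adjoint (1\<^sub>m n :: complex mat) = 1\<^sub>m n"
  by (rule eq_matI) auto

lemma mat_adjoint_smult: "mat_adjoint (c \<cdot>\<^sub>m A) = conjugate c \<cdot>\<^sub>m mat_adjoint A"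
  by (rule eq_matI) (auto simp: conjugate_dist_mul)

lemma mat_adjoint_minus:
  assumes "A \<in> carrier_mat m n" "B \<in> carrier_mat m n"
  shows "mat_adjoint (A - B :: complex mat) = mat_adjoint A - mat_adjoint B"
  using assms by (intro eq_matI) auto

lemma scalar_prod_mat_adjoint:
  fixes u v :: "complex vec"
  assumes "A \<in> carrier_mat m n" "u \<in> carrier_vec n" "v \<in> carrier_vec m"
  shows "(A *\<^sub>v u) \<bullet>c v = u \<bullet>c (mat_adjoint A *\<^sub>v v)"
proof -
  have "(A *\<^sub>v u) \<bullet>c v = (\<Sum>i<m. \<Sum>j<n. A $$ (i, j) * u $ j * conjugate (v $ i))"
    using assms by (auto simp: scalar_prod_def sum_distrib_right lessThan_atLeast0 intro!: sum.cong)
  also have "\<dots> = (\<Sum>j<n. \<Sum>i<m. A $$ (i, j) * u $ j * conjugate (v $ i))"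
    by (rule sum.swap)
  also have "\<dots> = (\<Sum>j<n. u $ j * (\<Sum>i<m. A $$ (i, j) * conjugate (v $ i)))"
    by (simp add: sum_distrib_left mult_ac)
  also have "\<dots> = u \<bullet>c (mat_adjoint A *\<^sub>v v)"
    using assms by (auto simp: scalar_prod_def lessThan_atLeast0 intro!: sum.cong)
  finally show ?thesis .
qed

lemma quadratic_form_congruence:
  fixes v :: "complex vec"
  assumes "X \<in> carrier_mat m n" "W \<in> carrier_mat n n" "v \<in> carrier_vec m"
  shows "((X * W * mat_adjoint X) *\<^sub>v v) \<bullet>c v
       = (W *\<^sub>v (mat_adjoint X *\<^sub>v v)) \<bullet>c (mat_adjoint X *\<^sub>v v)"
proof -
  have X': "mat_adjoint X \<in> carrier_mat n m" using assms by simp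
  note u = mult_mat_vec_carrier[OF X' assms(3)]
  have "(X * W * mat_adjoint X) *\<^sub>v v = X *\<^sub>v (W *\<^sub>v (mat_adjoint X *\<^sub>v v))"
    by (simp only: assoc_mult_mat_vec[OF mult_carrier_mat[OF assms(1,2)] X' assms(3)]
        assoc_mult_mat_vec[OF assms(1,2) u])
  then show ?thesis
    by (simp only: scalar_prod_mat_adjoint[OF assms(1) mult_mat_vec_carrier[OF assms(2) u] assms(3)])
qed

lemma mat_adjoint_congruence:
  assumes "X \<in> carrier_mat m n" "W \<in> carrier_mat n n" "mat_adjoint W = W"
  shows "mat_adjoint (X * W * mat_adjoint X) = X * W * mat_adjoint X"
  using mat_adjoint_mult[OF mult_carrier_mat[OF assms(1,2)] mat_adjoint_carrier[OF assms(1)]]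
    mat_adjoint_mult[OF assms(1,2)] assoc_mult_mat[OF assms(1,2) mat_adjoint_carrier[OF assms(1)]]
    assms(3) mat_adjoint_adjoint by metis

lemma pos_semidef_congruence:
  assumes "pos_semidef_mat n W" "X \<in> carrier_mat m n"
  shows "pos_semidef_mat m (X * W * mat_adjoint X)"
  using assms mult_mat_vec_carrier[OF mat_adjoint_carrier[OF assms(2)]]
  unfolding pos_semidef_mat_def
  by (auto simp: mat_adjoint_congruence[of X m n W] quadratic_form_congruence[of X m n W]
      simp del: assoc_mult_mat intro!: mult_carrier_mat[of _ m n])

text \<open>The right inverse makes \<open>mat_adjoint X\<close> injective, so the form of
  \<open>W\<close> is evaluated at a nonzero vector. \<open>X\<close> may be rectangular because the
  lemma is later applied to a block of rows of an invertible matrix.\<close>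

lemma pos_def_congruence:
  assumes "pos_def_mat n W" "X \<in> carrier_mat m n" "Y \<in> carrier_mat n m" "X * Y = 1\<^sub>m m"
  shows "pos_def_mat m (X * W * mat_adjoint X)"
proof -
  have "mat_adjoint X *\<^sub>v v \<noteq> 0\<^sub>v n" if v: "v \<in> carrier_vec m" "v \<noteq> 0\<^sub>v m" for v
  proof
    assume "mat_adjoint X *\<^sub>v v = 0\<^sub>v n"
    then have "(mat_adjoint Y * mat_adjoint X) *\<^sub>v v = mat_adjoint Y *\<^sub>v 0\<^sub>v n"
      using assms v by (simp add: assoc_mult_mat_vec[of _ m n _ m])
    moreover have "mat_adjoint Y * mat_adjoint X = 1\<^sub>m m"
      using assms mat_adjoint_mult[of X m n Y m] by simp
    ultimately show False
      using v assms(3) by (auto simp: scalar_prod_def)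
  qed
  with assms show ?thesis
    using mult_mat_vec_carrier[OF mat_adjoint_carrier[OF assms(2)]] unfolding pos_def_mat_def
    by (auto simp: mat_adjoint_congruence[of X m n W] quadratic_form_congruence[of X m n W]
        simp del: assoc_mult_mat intro!: mult_carrier_mat[of _ m n])
qed

text \<open>The form of \<open>W\<close> vanishes at each \<open>mat_adjoint X *\<^sub>v v\<close>,
  so definiteness makes all these vectors zero. This is the only route by which definiteness reaches
  the spectral part.\<close>

lemma pos_def_congruence_eq_0:
  assumes W: "pos_def_mat n W" and X: "X \<in> carrier_mat m n"
    and 0: "X * W * mat_adjoint X = 0\<^sub>m m m"
  shows "X = 0\<^sub>m m n"
proof -
  have "mat_adjoint X *\<^sub>v v = 0\<^sub>v n" if v: "v \<in> carrier_vec m" for v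
  proof (rule ccontr)
    assume "mat_adjoint X *\<^sub>v v \<noteq> 0\<^sub>v n"
    then have "0 < (W *\<^sub>v (mat_adjoint X *\<^sub>v v)) \<bullet>c (mat_adjoint X *\<^sub>v v)"
      using W X v mult_mat_vec_carrier[OF mat_adjoint_carrier[OF X] v]
      unfolding pos_def_mat_def by blast
    also have "\<dots> = ((X * W * mat_adjoint X) *\<^sub>v v) \<bullet>c v"
      using W X v by (simp add: quadratic_form_congruence[of X m n W] pos_def_mat_def del: assoc_mult_mat)
    also have "\<dots> = 0" using v by (auto simp: 0 scalar_prod_def)
    finally show False by simp
  qed
  then have *: "mat_adjoint X *\<^sub>v unit_vec m i = 0\<^sub>v n" for i
    by simp
  have "X $$ (i, j) = 0" if "i < m" "j < n" for i j
  proof -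
    have "(mat_adjoint X *\<^sub>v unit_vec m i) $ j = 0" using that * by simp
    then show ?thesis using that X by simp
  qed
  then show ?thesis using X by (intro eq_matI) auto
qed

subsection \<open>Spectral projections\<close>

text \<open>A monic polynomial in \<open>T\<close>, kept as its list of roots. The degree is the
  length of the list, and division by a linear factor deletes an entry.\<close>

fun lin_prod :: "nat \<Rightarrow> 'a::comm_ring_1 mat \<Rightarrow> 'a list \<Rightarrow> 'a mat" where
  "lin_prod n T [] = 1\<^sub>m n"
| "lin_prod n T (e # es) = (T - e \<cdot>\<^sub>m 1\<^sub>m n) * lin_prod n T es"

context
  fixes n :: nat and T :: "'a::comm_ring_1 mat"
  assumes T: "T \<in> carrier_mat n n"
begin

lemma lin_factor_carrier [simp]: "T - e \<cdot>\<^sub>m 1\<^sub>m n \<in> carrier_mat n n"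
  using T by (simp add: minus_carrier_mat)

lemma lin_prod_carrier [simp]: "lin_prod n T es \<in> carrier_mat n n"
  by (induction es) auto

lemma lin_factor_mult:
  assumes "X \<in> carrier_mat n n"
  shows "(T - e \<cdot>\<^sub>m 1\<^sub>m n) * X = T * X - e \<cdot>\<^sub>m X"
  using T assms
  by (simp add: minus_mult_distrib_mat[of _ n n _ _ n] mult_smult_assoc_mat[of _ n n _ n])

lemma mult_lin_factor:
  assumes "X \<in> carrier_mat n n"
  shows "X * (T - e \<cdot>\<^sub>m 1\<^sub>m n) = X * T - e \<cdot>\<^sub>m X"
  using T assms
  by (simp add: mult_minus_distrib_mat[of _ n n _ n] mult_smult_distrib[of _ n n _ n])

lemma lin_factor_commute:
  assumes "X \<in> carrier_mat n n" "T * X = X * T"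
  shows "(T - e \<cdot>\<^sub>m 1\<^sub>m n) * X = X * (T - e \<cdot>\<^sub>m 1\<^sub>m n)"
  using assms by (simp add: lin_factor_mult mult_lin_factor)

lemma lin_prod_commute:
  assumes X: "X \<in> carrier_mat n n" and "T * X = X * T"
  shows "lin_prod n T es * X = X * lin_prod n T es"
proof (induction es)
  case (Cons e es)
  have "lin_prod n T (e # es) * X = (T - e \<cdot>\<^sub>m 1\<^sub>m n) * (lin_prod n T es * X)"
    using X by (simp add: assoc_mult_mat[of _ n n _ n _ n])
  also have "\<dots> = ((T - e \<cdot>\<^sub>m 1\<^sub>m n) * X) * lin_prod n T es"
    using X Cons by (simp add: assoc_mult_mat[of _ n n _ n _ n])
  also have "\<dots> = X * lin_prod n T (e # es)"
    using X lin_factor_commute[OF assms] by (simp add: assoc_mult_mat[of _ n n _ n _ n])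
  finally show ?case .
qed (use X in simp)

lemma lin_prod_self_commute: "T * lin_prod n T es = lin_prod n T es * T"
  using lin_prod_commute[of T] T by simp

lemma lin_prod_append: "lin_prod n T (xs @ ys) = lin_prod n T xs * lin_prod n T ys"
  by (induction xs) (simp_all add: left_mult_one_mat[of _ n n] assoc_mult_mat[of _ n n _ n _ n])

text \<open>All factors are polynomials in \<open>T\<close> and commute, so any chosen root can be
  split off at the head.\<close>

lemma lin_prod_move_front: "lin_prod n T (xs @ y # ys) = lin_prod n T (y # xs @ ys)"
proof -
  have "lin_prod n T (xs @ y # ys) = (lin_prod n T xs * (T - y \<cdot>\<^sub>m 1\<^sub>m n)) * lin_prod n T ys"
    by (simp add: lin_prod_append assoc_mult_mat[of _ n n _ n _ n])
  also have "\<dots> = ((T - y \<cdot>\<^sub>m 1\<^sub>m n) * lin_prod n T xs) * lin_prod n T ys"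
    by (simp only: lin_factor_commute[OF lin_prod_carrier lin_prod_self_commute])
  finally show ?thesis by (simp add: lin_prod_append assoc_mult_mat[of _ n n _ n _ n])
qed

text \<open>On the columns of \<open>X\<close> the matrix \<open>T\<close> acts as the scalar
  \<open>e\<close>, hence a factor with root \<open>f\<close> acts as \<open>e - f\<close>. With
  \<open>X\<close> the product itself, this computes its square.\<close>

lemma lin_prod_eigen:
  assumes X: "X \<in> carrier_mat n n" and TX: "T * X = e \<cdot>\<^sub>m X"
  shows "lin_prod n T es * X = (\<Prod>f\<leftarrow>es. e - f) \<cdot>\<^sub>m X"
proof (induction es)
  case Nil
  then show ?case using X by (auto intro!: eq_matI)
next
  case (Cons f es)
  have "lin_prod n T (f # es) * X = (T - f \<cdot>\<^sub>m 1\<^sub>m n) * ((\<Prod>f\<leftarrow>es. e - f) \<cdot>\<^sub>m X)"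
    using X Cons by (simp add: assoc_mult_mat[of _ n n _ n _ n])
  also have "\<dots> = (\<Prod>f\<leftarrow>es. e - f) \<cdot>\<^sub>m (T * X - f \<cdot>\<^sub>m X)"
    using X by (simp add: mult_smult_distrib[of _ n n] lin_factor_mult)
  also have "\<dots> = (\<Prod>f\<leftarrow>f # es. e - f) \<cdot>\<^sub>m X"
    using X unfolding TX by (intro eq_matI) (auto simp: algebra_simps)
  finally show ?case .
qed

end

section \<open>An annihilating polynomial from the Schur form\<close>

lemma lin_prod_similar:
  assumes "T \<in> carrier_mat n n" "B \<in> carrier_mat n n" "P \<in> carrier_mat n n" "P' \<in> carrier_mat n n"
    and "P * P' = 1\<^sub>m n" "P' * P = 1\<^sub>m n" "T = P * B * P'"
  shows "lin_prod n T es = P * lin_prod n B es * P'"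
proof (induction es)
  case Nil
  then show ?case using assms by simp
next
  case (Cons e es)
  have "lin_prod n T (e # es) = T * lin_prod n T es - e \<cdot>\<^sub>m lin_prod n T es"
    using assms by (simp add: lin_factor_mult)
  also have "T * lin_prod n T es = P * B * (P' * P) * lin_prod n B es * P'"
    unfolding Cons using assms(1-4) by (subst assms(7)) (simp add: assoc_mult_mat[of _ n n _ n _ n] mult_carrier_mat[of _ n n _ n])
  also have "\<dots> = P * (B * lin_prod n B es) * P'"
    using assms by (simp add: assoc_mult_mat[of _ n n _ n _ n] mult_carrier_mat[of _ n n _ n])
  also have "\<dots> - e \<cdot>\<^sub>m lin_prod n T es = P * (B * lin_prod n B es - e \<cdot>\<^sub>m lin_prod n B es) * P'"
    using assms(2-4) unfolding Cons
    by (simp add: minus_mult_distrib_mat[of _ n n _ _ n] mult_minus_distrib_mat[of _ n n _ n]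
       mult_smult_distrib[of _ n n _ n] mult_smult_assoc_mat[of _ n n _ n] mult_carrier_mat[of _ n n _ n])
  finally show ?case using assms by (simp add: lin_factor_mult)
qed

text \<open>Cayley-Hamilton for triangular matrices, one column per factor. In column
  \<open>j \<le> k\<close> of the new factor the entries below the diagonal vanish, and so does the
  entry at \<open>(k, k)\<close>. What remains lies in rows \<open>l < k\<close>, and these meet
  columns of the previous product that are already zero.\<close>

lemma lin_prod_upper_triangular:
  assumes B: "B \<in> carrier_mat n n" and ut: "upper_triangular B"
    and "k \<le> n" "i < n" "j < k"
  shows "lin_prod n B (take k (diag_mat B)) $$ (i, j) = 0"
  using assms(3-5)
proof (induction k arbitrary: i j)
  case (Suc k)
  let ?P = "lin_prod n B (take k (diag_mat B))"
  let ?F = "B - B $$ (k, k) \<cdot>\<^sub>m 1\<^sub>m n"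
  have P: "?P \<in> carrier_mat n n" and F: "?F \<in> carrier_mat n n"
    using B by simp_all
  have "take (Suc k) (diag_mat B) = take k (diag_mat B) @ [B $$ (k, k)]"
    using B Suc.prems by (simp add: diag_mat_def take_Suc_conv_app_nth)
  then have eq: "lin_prod n B (take (Suc k) (diag_mat B)) = ?P * ?F"
    using B by (simp add: lin_prod_append right_mult_one_mat[OF F])
  have "?P $$ (i, l) * ?F $$ (l, j) = 0" if "l < n" for l
  proof (cases "l < k")
    case True
    then show ?thesis using Suc by simp
  next
    case False
    then have "l = j \<and> j = k \<or> j < l" using Suc.prems by auto
    then show ?thesis
      using Suc.prems that B upper_triangularD[OF ut, of j l] by auto
  qed
  then show ?case
    unfolding eq using P F Suc.prems by (auto simp: scalar_prod_def intro!: sum.neutral)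
qed simp

text \<open>The roots are the full diagonal of a Schur form of \<open>T\<close>: the preceding
  induction then clears all columns, and similarity carries the result back to
  \<open>T\<close>.\<close>

lemma lin_prod_annihilates:
  fixes T :: "complex mat"
  assumes T: "T \<in> carrier_mat n n"
  obtains es where "lin_prod n T es = 0\<^sub>m n n"
proof -
  obtain es where es: "char_poly T = (\<Prod>e\<leftarrow>es. [:- e, 1:])"
    using char_poly_factorized[OF T] by auto
  obtain B where B: "B \<in> carrier_mat n n" "upper_triangular B" "similar_mat T B"
    using schur_decomposition_exists[OF T es] by auto
  then obtain P P' where PP: "similar_mat_wit T B P P'"
    by (auto simp: similar_mat_def)
  note w = similar_mat_witD2[OF T PP]
  have "lin_prod n B (diag_mat B) = 0\<^sub>m n n"
    using lin_prod_upper_triangular[OF B(1,2), of n] carrier_matD[OF B(1)]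
      carrier_matD[OF lin_prod_carrier[OF B(1), of "diag_mat B"]]
    by (intro eq_matI) (simp_all add: diag_mat_def)
  then have "lin_prod n T (diag_mat B) = 0\<^sub>m n n"
    using lin_prod_similar[OF T B(1) w(6,7) w(1,2) w(3), of "diag_mat B"] w by simp
  then show thesis by (rule that)
qed

section \<open>Self-adjointness relative to a positive definite matrix\<close>

lemma mat_eq_of_minus_eq_0:
  fixes A B :: "'a::ab_group_add mat"
  assumes "A \<in> carrier_mat m n" "B \<in> carrier_mat m n" "A - B = 0\<^sub>m m n"
  shows "A = B"
proof (rule eq_matI)
  fix i j assume "i < dim_row B" "j < dim_col B"
  then have "(A - B) $$ (i, j) = 0" using assms by simp
  then show "A $$ (i, j) = B $$ (i, j)"
    using assms(1,2) \<open>i < dim_row B\<close> \<open>j < dim_col B\<close> by simp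
qed (use assms in auto)

text \<open>The adjoint turns \<open>e\<close> into \<open>cnj e\<close>, which is harmless exactly
  because \<open>e\<close> is real.\<close>

lemma lin_factor_symmetric:
  fixes T :: "complex mat"
  assumes T: "T \<in> carrier_mat n n" and W: "W \<in> carrier_mat n n"
    and TW: "T * W = W * mat_adjoint T" and "e \<in> \<real>"
  shows "(T - e \<cdot>\<^sub>m 1\<^sub>m n) * W = W * mat_adjoint (T - e \<cdot>\<^sub>m 1\<^sub>m n)"
proof -
  have "mat_adjoint (T - e \<cdot>\<^sub>m 1\<^sub>m n) = mat_adjoint T - e \<cdot>\<^sub>m 1\<^sub>m n"
    using T \<open>e \<in> \<real>\<close> by (simp add: mat_adjoint_minus[of _ n n] mat_adjoint_smult Reals_cnj_iff)
  then show ?thesis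
    using T W by (simp add: lin_factor_mult mult_lin_factor TW)
qed

text \<open>Passing the factors through \<open>W\<close> one by one produces their adjoints in the
  original order, while the adjoint of a product reverses it. Commutativity of the factors
  reconciles the two.\<close>

lemma lin_prod_symmetric:
  fixes T :: "complex mat"
  assumes T: "T \<in> carrier_mat n n" and W: "W \<in> carrier_mat n n"
    and TW: "T * W = W * mat_adjoint T" and "set es \<subseteq> \<real>"
  shows "lin_prod n T es * W = W * mat_adjoint (lin_prod n T es)"
  using assms(4)
proof (induction es)
  case Nil
  then show ?case using W by simp
next
  case (Cons e es)
  define F where "F = T - e \<cdot>\<^sub>m 1\<^sub>m n"
  define R where "R = lin_prod n T es"
  have F: "F \<in> carrier_mat n n" and R: "R \<in> carrier_mat n n"
    using T by (simp_all add: F_def R_def)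
  note F' = mat_adjoint_carrier[OF F] and R' = mat_adjoint_carrier[OF R]
  have FW: "F * W = W * mat_adjoint F"
    using lin_factor_symmetric[OF T W TW] Cons.prems by (simp add: F_def)
  have RW: "R * W = W * mat_adjoint R"
    using Cons by (simp add: R_def)
  have FR: "F * R = R * F"
    unfolding F_def R_def
    by (rule lin_factor_commute[OF T lin_prod_carrier[OF T] lin_prod_self_commute[OF T]])
  have "F * R * W = F * (W * mat_adjoint R)"
    using F R W by (simp add: RW)
  also have "\<dots> = W * (mat_adjoint F * mat_adjoint R)"
    using assoc_mult_mat[OF F W R'] assoc_mult_mat[OF W F' R'] FW by simp
  also have "mat_adjoint F * mat_adjoint R = mat_adjoint (F * R)"
    unfolding FR by (rule mat_adjoint_mult[OF R F, symmetric])
  finally show ?case by (simp add: F_def R_def)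
qed

text \<open>Evaluating \<open>R T W R\<^sup>*\<close> in two ways gives \<open>e R W R\<^sup>* = cnj e R W R\<^sup>*\<close>.\<close>

lemma real_eigenvalue:
  assumes W: "pos_def_mat n W" and T: "T \<in> carrier_mat n n" and TW: "T * W = W * mat_adjoint T"
    and R: "R \<in> carrier_mat n n" "R \<noteq> 0\<^sub>m n n" and RT: "R * T = e \<cdot>\<^sub>m R"
  shows "e \<in> \<real>"
proof -
  have Wc: "W \<in> carrier_mat n n" using W by (simp add: pos_def_mat_def)
  note T' = mat_adjoint_carrier[OF T] and R' = mat_adjoint_carrier[OF R(1)]
  define H where "H = R * W * mat_adjoint R"
  have H: "H \<in> carrier_mat n n"
    unfolding H_def by (rule mult_carrier_mat[OF mult_carrier_mat[OF R(1) Wc] R'])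
  have "e \<cdot>\<^sub>m H = (e \<cdot>\<^sub>m R) * W * mat_adjoint R"
    using R(1) Wc R' by (simp add: H_def mult_smult_assoc_mat[of _ n n _ n] mult_carrier_mat[of R n n W n])
  also have "\<dots> = R * (T * W) * mat_adjoint R"
    unfolding RT[symmetric] using assoc_mult_mat[OF R(1) T Wc] by simp
  also have "\<dots> = R * W * (mat_adjoint T * mat_adjoint R)"
    unfolding TW using R(1) Wc R' T'
    by (simp add: assoc_mult_mat[of _ n n _ n _ n] mult_carrier_mat[of _ n n _ n])
  also have "mat_adjoint T * mat_adjoint R = cnj e \<cdot>\<^sub>m mat_adjoint R"
    using mat_adjoint_mult[OF R(1) T] by (simp add: RT mat_adjoint_smult)
  also have "R * W * (cnj e \<cdot>\<^sub>m mat_adjoint R) = cnj e \<cdot>\<^sub>m H"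
    unfolding H_def by (rule mult_smult_distrib[OF mult_carrier_mat[OF R(1) Wc] R'])
  finally have eq: "e \<cdot>\<^sub>m H = cnj e \<cdot>\<^sub>m H" .
  have "H \<noteq> 0\<^sub>m n n"
    using pos_def_congruence_eq_0[OF W R(1)] R(2) by (auto simp: H_def)
  then obtain i j where ij: "i < n" "j < n" "H $$ (i, j) \<noteq> 0"
    using eq_matI[of H "0\<^sub>m n n"] H by fastforce
  have "(e \<cdot>\<^sub>m H) $$ (i, j) = (cnj e \<cdot>\<^sub>m H) $$ (i, j)"
    by (simp only: eq)
  then have "e = cnj e" using H ij by simp
  then show ?thesis by (simp add: Reals_cnj_iff)
qed

text \<open>Here \<open>X W X^* = X X W = 0\<close>, so definiteness applies. A self-adjoint
  operator has no nilpotent part, which is what rules out multiple roots below.\<close>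

lemma symmetric_square_eq_0:
  assumes W: "pos_def_mat n W" and X: "X \<in> carrier_mat n n" and XW: "X * W = W * mat_adjoint X"
    and XX: "X * X = 0\<^sub>m n n"
  shows "X = 0\<^sub>m n n"
proof (rule pos_def_congruence_eq_0[OF W X])
  have Wc: "W \<in> carrier_mat n n" using W by (simp add: pos_def_mat_def)
  have "X * W * mat_adjoint X = X * (W * mat_adjoint X)"
    by (rule assoc_mult_mat[OF X Wc mat_adjoint_carrier[OF X]])
  also have "\<dots> = X * (X * W)"
    by (simp only: XW)
  also have "\<dots> = X * X * W"
    using assoc_mult_mat[OF X X Wc] by simp
  also have "\<dots> = 0\<^sub>m n n"
    using Wc by (simp add: XX)
  finally show "X * W * mat_adjoint X = 0\<^sub>m n n" .
qed

text \<open>A shortest annihilating product of linear factors plays the role of the minimal polynomial: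
  minimality forces its roots to be real and distinct, and omitting one factor leaves a multiple
  of a spectral projection.\<close>

lemma spectral_idempotent:
  assumes W0: "pos_def_mat n W0" and T: "T \<in> carrier_mat n n"
    and TW0: "T * W0 = W0 * mat_adjoint T" and nonscalar: "T \<notin> real_scalar_mats n"
  obtains Q where "Q \<in> carrier_mat n n" "Q * Q = Q" "Q \<noteq> 0\<^sub>m n n" "Q \<noteq> 1\<^sub>m n"
    "\<And>W. W \<in> carrier_mat n n \<Longrightarrow> T * W = W * mat_adjoint T \<Longrightarrow> Q * W = W * mat_adjoint Q"
proof -
  let ?L = "lin_prod n T"
  note L = lin_prod_carrier[OF T] and F = lin_factor_carrier[OF T]
  have W0c: "W0 \<in> carrier_mat n n" using W0 by (simp add: pos_def_mat_def)
  obtain es1 where "?L es1 = 0\<^sub>m n n"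
    using lin_prod_annihilates[OF T] .
  then obtain es where es0: "?L es = 0\<^sub>m n n"
    and minimal: "\<And>fs. ?L fs = 0\<^sub>m n n \<Longrightarrow> length es \<le> length fs"
    using ex_has_least_nat[of "\<lambda>es. ?L es = 0\<^sub>m n n" es1 length] by blast
  \<comment> \<open>Without the factor for \<open>e\<close> the product is nonzero by minimality,
    and multiplying it by \<open>T - e I\<close> gives zero. Its nonzero rows are therefore left
    eigenvectors for \<open>e\<close>, and \<open>real_eigenvalue\<close> applies.\<close>
  have "set es \<subseteq> \<real>"
  proof
    fix e assume "e \<in> set es"
    then obtain xs ys where es: "es = xs @ e # ys" by (meson split_list)
    let ?R = "?L (xs @ ys)"
    have "?R * (T - e \<cdot>\<^sub>m 1\<^sub>m n) = ?L (e # xs @ ys)"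
      using lin_factor_commute[OF T L lin_prod_self_commute[OF T]] by simp
    also have "\<dots> = 0\<^sub>m n n"
      using es0 lin_prod_move_front[OF T] by (simp only: es)
    finally have "?R * T - e \<cdot>\<^sub>m ?R = 0\<^sub>m n n"
      by (simp only: mult_lin_factor[OF T L])
    then have "?R * T = e \<cdot>\<^sub>m ?R"
      by (rule mat_eq_of_minus_eq_0[OF mult_carrier_mat[OF L T] smult_carrier_mat[OF L]])
    moreover have "?R \<noteq> 0\<^sub>m n n" using minimal[of "xs @ ys"] by (auto simp: es)
    ultimately show "e \<in> \<real>" by (intro real_eigenvalue[OF W0 T TW0 L])
  qed
  \<comment> \<open>For a double root \<open>y\<close> with factor \<open>F\<close> and remaining
    product \<open>R\<close>, the square of \<open>F R\<close> is \<open>R F F R = 0\<close>. As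
    \<open>F R\<close> is itself self-adjoint for the form, it vanishes already, against
    minimality.\<close>
  have "distinct es"
  proof (rule ccontr)
    assume "\<not> distinct es"
    then obtain xs y ys zs where es: "es = xs @ [y] @ ys @ [y] @ zs"
      using not_distinct_decomp by blast
    let ?F = "T - y \<cdot>\<^sub>m 1\<^sub>m n" and ?R = "?L (xs @ ys @ zs)"
    have FR: "?F * ?R = ?R * ?F"
      by (rule lin_factor_commute[OF T L lin_prod_self_commute[OF T]])
    have "?L es = ?L (y # (xs @ ys) @ y # zs)"
      unfolding es using lin_prod_move_front[OF T, of xs y "ys @ y # zs"] by simp
    also have "\<dots> = ?F * (?F * ?R)"
      using lin_prod_move_front[OF T, of "xs @ ys" y zs] by simp
    finally have FFR: "?F * (?F * ?R) = 0\<^sub>m n n"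
      using es0 by simp
    have "(?F * ?R) * (?F * ?R) = (?R * ?F) * (?F * ?R)"
      by (simp only: FR)
    also have "\<dots> = ?R * (?F * (?F * ?R))"
      by (rule assoc_mult_mat[OF L F mult_carrier_mat[OF F L]])
    also have "\<dots> = 0\<^sub>m n n"
      using L[of "xs @ ys @ zs"] by (simp add: FFR)
    finally have "?L (y # xs @ ys @ zs) * ?L (y # xs @ ys @ zs) = 0\<^sub>m n n" by simp
    moreover have "?L (y # xs @ ys @ zs) * W0 = W0 * mat_adjoint (?L (y # xs @ ys @ zs))"
      using \<open>set es \<subseteq> \<real>\<close> by (intro lin_prod_symmetric[OF T W0c TW0]) (auto simp: es)
    ultimately have "?L (y # xs @ ys @ zs) = 0\<^sub>m n n"
      using symmetric_square_eq_0[OF W0 L] by blast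
    then show False using minimal[of "y # xs @ ys @ zs"] by (simp add: es)
  qed
  \<comment> \<open>The empty product is the identity, so it annihilates only in size zero, where
    \<open>T\<close> is a real scalar matrix.\<close>
  have "es \<noteq> []"
  proof
    assume "es = []"
    then have "1\<^sub>m n = (0\<^sub>m n n :: complex mat)" using es0 by simp
    then have "T = T * 0\<^sub>m n n" using right_mult_one_mat[OF T] by simp
    then have "T = complex_of_real 0 \<cdot>\<^sub>m 1\<^sub>m n" using T by (auto intro!: eq_matI)
    then show False using nonscalar unfolding real_scalar_mats_def by blast
  qed
  then obtain e fs where es: "es = e # fs" by (cases es) auto
  \<comment> \<open>The columns of \<open>R\<close> lie in the eigenspace of \<open>e\<close>, and
    \<open>R R = c R\<close>. Since the roots are distinct, \<open>c\<close> is nonzero, and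
    dividing by it gives the projection onto that eigenspace.\<close>
  define R where "R = ?L fs"
  define c where "c = (\<Prod>f\<leftarrow>fs. e - f)"
  have R: "R \<in> carrier_mat n n" using L by (simp add: R_def)
  have "T * R - e \<cdot>\<^sub>m R = 0\<^sub>m n n"
    using es0 lin_factor_mult[OF T R] by (simp add: es R_def)
  then have TR: "T * R = e \<cdot>\<^sub>m R"
    by (rule mat_eq_of_minus_eq_0[OF mult_carrier_mat[OF T R] smult_carrier_mat[OF R]])
  have RR: "R * R = c \<cdot>\<^sub>m R"
    using lin_prod_eigen[OF T R TR] by (simp add: R_def c_def)
  have c0: "c \<noteq> 0"
    using \<open>distinct es\<close> by (auto simp: c_def es prod_list_zero_iff)
  \<comment> \<open>Reality of \<open>c\<close> lets the normalization by \<open>inverse c\<close>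
    pass through the adjoint.\<close>
  have "(\<Prod>f\<leftarrow>gs. e - f) \<in> \<real>" if "set gs \<subseteq> \<real>" for gs
    using that \<open>set es \<subseteq> \<real>\<close> by (induction gs) (auto simp: es)
  then have "c \<in> \<real>"
    using \<open>set es \<subseteq> \<real>\<close> by (simp add: c_def es)
  define Q where "Q = inverse c \<cdot>\<^sub>m R"
  have Q: "Q \<in> carrier_mat n n" using R by (simp add: Q_def)
  have RQ: "R = c \<cdot>\<^sub>m Q" using R c0 by (auto simp: Q_def intro!: eq_matI)
  show thesis
  proof (rule that)
    show "Q \<in> carrier_mat n n" by (rule Q)
    have "Q * Q = inverse c \<cdot>\<^sub>m (inverse c \<cdot>\<^sub>m (R * R))"
      using R by (simp add: Q_def mult_smult_assoc_mat[of _ n n _ n] mult_smult_distrib[of _ n n _ n])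
    also have "\<dots> = Q"
      using R c0 unfolding RR by (auto simp: Q_def intro!: eq_matI)
    finally show "Q * Q = Q" .
    have "R \<noteq> 0\<^sub>m n n" using minimal[of fs] by (auto simp: R_def es)
    then show "Q \<noteq> 0\<^sub>m n n" using RQ by auto
    show "Q \<noteq> 1\<^sub>m n"
    proof
      assume "Q = 1\<^sub>m n"
      then have R1: "R = c \<cdot>\<^sub>m 1\<^sub>m n" using RQ by simp
      then have cT: "c \<cdot>\<^sub>m T = e \<cdot>\<^sub>m (c \<cdot>\<^sub>m 1\<^sub>m n)"
        using TR T by (simp add: mult_smult_distrib[of _ n n _ n])
      have "T = inverse c \<cdot>\<^sub>m (c \<cdot>\<^sub>m T)"
        using c0 by (auto intro!: eq_matI)
      also have "\<dots> = e \<cdot>\<^sub>m 1\<^sub>m n"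
        unfolding cT using c0 by (auto intro!: eq_matI)
      finally have "T = e \<cdot>\<^sub>m 1\<^sub>m n" .
      moreover have "e \<in> \<real>" using \<open>set es \<subseteq> \<real>\<close> by (simp add: es)
      ultimately show False
        using nonscalar unfolding real_scalar_mats_def Reals_def by auto
    qed
  next
    fix W assume W: "W \<in> carrier_mat n n" "T * W = W * mat_adjoint T"
    have "R * W = W * mat_adjoint R"
      using lin_prod_symmetric[OF T W] \<open>set es \<subseteq> \<real>\<close> by (simp add: R_def es)
    moreover have "mat_adjoint Q = inverse c \<cdot>\<^sub>m mat_adjoint R"
      using \<open>c \<in> \<real>\<close> by (simp add: Q_def mat_adjoint_smult Reals_cnj_iff)
    ultimately show "Q * W = W * mat_adjoint Q"
      using W(1) R by (simp add: Q_def mult_smult_assoc_mat[of _ n n _ n] mult_smult_distrib[of _ n n _ n])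
  qed
qed

subsection \<open>Normal form of idempotents\<close>

text \<open>The determinant is one, so \<open>X\<close> can be cancelled from
  \<open>X * X = X\<close>.\<close>

lemma upper_unitriangular_idempotent:
  fixes X :: "'a::field mat"
  assumes X: "X \<in> carrier_mat n n" and ut: "upper_triangular X"
    and diag: "\<And>i. i < n \<Longrightarrow> X $$ (i, i) = 1" and XX: "X * X = X"
  shows "X = 1\<^sub>m n"
proof -
  have "prod_list (diag_mat X) = 1"
    using X diag unfolding prod_list_diag_prod by simp
  then have "det X \<noteq> 0" using det_upper_triangular[OF ut X] by simp
  from det_non_zero_imp_unit[OF X this, of "()"]
  obtain Y where Y: "Y \<in> carrier_mat n n" "Y * X = 1\<^sub>m n"
    unfolding Units_def by (auto simp: ring_mat_simps)
  then have "X = Y * X * X" using X by simp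
  also have "\<dots> = Y * X" using assoc_mult_mat[OF Y(1) X X] XX by simp
  finally show ?thesis using Y by simp
qed

text \<open>The complementary idempotent \<open>1\<^sub>m n - X\<close> is unitriangular, hence the
  identity.\<close>

lemma upper_nilpotent_idempotent:
  fixes X :: "'a::field mat"
  assumes X: "X \<in> carrier_mat n n" and ut: "upper_triangular X"
    and diag: "\<And>i. i < n \<Longrightarrow> X $$ (i, i) = 0" and XX: "X * X = X"
  shows "X = 0\<^sub>m n n"
proof -
  let ?Y = "1\<^sub>m n - X"
  have Y: "?Y \<in> carrier_mat n n" using X by (simp add: minus_carrier_mat)
  have "?Y * ?Y = ?Y * 1\<^sub>m n - ?Y * X"
    using X Y by (intro mult_minus_distrib_mat[of _ n n]) auto
  also have "?Y * X = 0\<^sub>m n n"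
    using X XX by (auto simp: minus_mult_distrib_mat[of _ n n])
  finally have "?Y * ?Y = ?Y" using X Y by (auto intro!: eq_matI)
  moreover have "upper_triangular ?Y"
    using X ut by (auto intro!: upper_triangularI dest: upper_triangularD)
  ultimately have "?Y = 1\<^sub>m n"
    using X diag by (intro upper_unitriangular_idempotent[OF Y]) auto
  then have eq: "?Y $$ (i, j) = 1\<^sub>m n $$ (i, j)" for i j by simp
  show ?thesis
  proof (rule eq_matI)
    fix i j assume "i < dim_row (0\<^sub>m n n :: 'a mat)" "j < dim_col (0\<^sub>m n n :: 'a mat)"
    then show "X $$ (i, j) = 0\<^sub>m n n $$ (i, j)"
      using X eq[of i j] by (cases "i = j") simp_all
  qed (use X in simp_all)
qed

lemma four_block_mat_eq_diag:
  assumes "A \<in> carrier_mat m n" "D \<in> carrier_mat k l" "A' \<in> carrier_mat m n" "D' \<in> carrier_mat k l"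
    and eq: "four_block_mat A B C D = four_block_mat A' B' C' D'"
  shows "A = A'" "D = D'"
proof -
  have ent: "four_block_mat A B C D $$ (i, j) = four_block_mat A' B' C' D' $$ (i, j)" for i j
    by (simp only: eq)
  show "A = A'"
  proof (rule eq_matI)
    fix i j assume "i < dim_row A'" "j < dim_col A'"
    then show "A $$ (i, j) = A' $$ (i, j)" using ent[of i j] assms(1-4) by simp
  qed (use assms in auto)
  show "D = D'"
  proof (rule eq_matI)
    fix i j assume "i < dim_row D'" "j < dim_col D'"
    then show "D $$ (i, j) = D' $$ (i, j)" using ent[of "i + m" "j + n"] assms(1-4) by simp
  qed (use assms in auto)
qed

text \<open>Both block sizes are parameters, so the total size is the sum \<open>m + k\<close> and
  no subtraction appears; either of them may be zero.\<close>

definition coord_proj :: "nat \<Rightarrow> nat \<Rightarrow> 'a::semiring_1 mat" where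
  "coord_proj m k = four_block_mat (1\<^sub>m m) (0\<^sub>m m k) (0\<^sub>m k m) (0\<^sub>m k k)"

lemma coord_proj_carrier [simp]: "coord_proj m k \<in> carrier_mat (m + k) (m + k)"
  by (simp add: coord_proj_def)

text \<open>With the eigenvalue 1 listed first, the Schur form has diagonal blocks \<open>I\<close>
  and \<open>0\<close> and some upper right block \<open>Z\<close>; a shear by \<open>Z\<close> then
  removes \<open>Z\<close>.\<close>

lemma idempotent_similar_coord_proj:
  fixes Q :: "complex mat"
  assumes Q: "Q \<in> carrier_mat n n" and QQ: "Q * Q = Q"
  obtains m k where "n = m + k" "similar_mat Q (coord_proj m k)"
proof -
  obtain es where es: "char_poly Q = (\<Prod>e\<leftarrow>es. [:- e, 1:])"
    using char_poly_factorized[OF Q] by auto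
  have idem: "B * B = B" if "B \<in> carrier_mat n n" "similar_mat_wit Q B P P'" for B P P'
  proof -
    note w = similar_mat_witD2[OF Q that(2)]
    note w' = similar_mat_witD2[OF that(1) similar_mat_wit_sym[OF that(2)]]
    have QP: "Q * P \<in> carrier_mat n n" using w' by simp
    have "B * B = P' * (Q * P) * (P' * (Q * P))"
      using w' assoc_mult_mat[OF w'(6) w'(5) w'(7)] by simp
    also have "\<dots> = P' * (Q * P * (P' * (Q * P)))"
      using w' QP by (intro assoc_mult_mat[of _ n n _ n _ n] mult_carrier_mat)
    also have "Q * P * (P' * (Q * P)) = Q * P * P' * (Q * P)"
      using w' QP by (intro assoc_mult_mat[of _ n n _ n _ n, symmetric] mult_carrier_mat)
    also have "Q * P * P' = Q"
      using w' assoc_mult_mat[OF Q w'(7) w'(6)] by simp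
    also have "Q * (Q * P) = Q * P"
      using assoc_mult_mat[OF Q Q w'(7)] by (simp add: QQ)
    also have "P' * (Q * P) = B"
      using w'(3) assoc_mult_mat[OF w'(6) Q w'(7)] by simp
    finally show ?thesis .
  qed
  \<comment> \<open>For a triangular matrix only the term \<open>l = i\<close> survives in the
    diagonal entry of the square, so that entry equals its own square.\<close>
  have diag01: "B $$ (i, i) = 0 \<or> B $$ (i, i) = 1"
    if "B \<in> carrier_mat n n" "upper_triangular B" "B * B = B" "i < n" for B :: "complex mat" and i
  proof -
    have "B $$ (i, i) = (\<Sum>l = 0..<n. B $$ (i, l) * B $$ (l, i))"
      using that(1,4) arg_cong[OF that(3), of "\<lambda>M. M $$ (i, i)"] by (simp add: scalar_prod_def)
    also have "\<dots> = (\<Sum>l \<in> {i}. B $$ (i, l) * B $$ (l, i))"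
    proof (rule sum.mono_neutral_right)
      show "\<forall>l\<in>{0..<n} - {i}. B $$ (i, l) * B $$ (l, i) = 0"
        using that upper_triangularD[OF that(2)] by (auto simp: neq_iff)
    qed (use that in auto)
    finally show ?thesis by simp
  qed
  obtain B P P' where BP: "schur_decomposition Q es = (B, P, P')"
    by (cases "schur_decomposition Q es") auto
  have QB: "similar_mat_wit Q B P P'" and ut: "upper_triangular B" and B_es: "diag_mat B = es"
    using schur_decomposition[OF Q es BP] by auto
  have B: "B \<in> carrier_mat n n" using similar_mat_witD2[OF Q QB] by auto
  have "set es \<subseteq> {0, 1}"
  proof
    fix e assume "e \<in> set es"
    then obtain i where "i < n" "e = B $$ (i, i)"
      using B B_es by (auto simp: diag_mat_def)
    then show "e \<in> {0, 1}" using diag01[OF B ut idem[OF B QB]] by blast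
  qed
  \<comment> \<open>Repeating the Schur decomposition with the eigenvalues sorted separates the unitriangular block
    from the strictly triangular one; each of them is idempotent.\<close>
  define m where "m = length (filter (\<lambda>e. e = 1) es)"
  define k where "k = length (filter (\<lambda>e. e \<noteq> 1) es)"
  define fs where "fs = replicate m (1::complex) @ replicate k 0"
  have len: "m + k = n"
    using B_es B sum_length_filter_compl[of "\<lambda>e. e = 1" es] by (auto simp: m_def k_def diag_mat_def)
  have "(\<Prod>e\<leftarrow>es. g e) = (\<Prod>e\<leftarrow>fs. g e)" for g :: "complex \<Rightarrow> complex poly"
    using \<open>set es \<subseteq> {0, 1}\<close> unfolding fs_def m_def k_def
    by (induction es) (auto simp: mult_ac)
  with es have fs: "char_poly Q = (\<Prod>e\<leftarrow>fs. [:- e, 1:])" by simp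
  obtain C R R' where CR: "schur_decomposition Q fs = (C, R, R')"
    by (cases "schur_decomposition Q fs") auto
  have C: "similar_mat_wit Q C R R'" "upper_triangular C" "diag_mat C = fs"
    using schur_decomposition[OF Q fs CR] by auto
  have Cc: "C \<in> carrier_mat n n" using similar_mat_witD2[OF Q C(1)] by auto
  have CC: "C * C = C" by (rule idem[OF Cc C(1)])
  have diagC: "C $$ (i, i) = (if i < m then 1 else 0)" if "i < n" for i
  proof -
    have "C $$ (i, i) = diag_mat C ! i" using that Cc by (simp add: diag_mat_def)
    then show ?thesis using that len by (simp add: C(3) fs_def nth_append)
  qed
  define U where "U = mat m m (\<lambda>(i, j). C $$ (i, j))"
  define Z where "Z = mat m k (\<lambda>(i, j). C $$ (i, j + m))"
  define D where "D = mat k k (\<lambda>(i, j). C $$ (i + m, j + m))"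
  have carr: "U \<in> carrier_mat m m" "Z \<in> carrier_mat m k" "D \<in> carrier_mat k k"
    by (simp_all add: U_def Z_def D_def)
  have C_block: "C = four_block_mat U Z (0\<^sub>m k m) D"
    using Cc len upper_triangularD[OF C(2)]
    by (intro eq_matI) (auto simp: U_def Z_def D_def)
  \<comment> \<open>Only the diagonal blocks of \<open>C * C = C\<close> carry information: once
    \<open>U\<close> is the identity and \<open>D\<close> is zero, the upper right block merely says
    \<open>Z = Z\<close>.\<close>
  have "four_block_mat (U * U) (U * Z + Z * D) (0\<^sub>m k m) (D * D) = four_block_mat U Z (0\<^sub>m k m) D"
    using CC mult_four_block_mat[OF carr(1,2) zero_carrier_mat carr(3) carr(1,2) zero_carrier_mat carr(3)]
      carr unfolding C_block by simp
  moreover have UU: "U * U \<in> carrier_mat m m" "D * D \<in> carrier_mat k k"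
    using carr by simp_all
  ultimately have "U * U = U" "D * D = D"
    using four_block_mat_eq_diag[of "U * U" m m "D * D" k k] carr by blast+
  have "U = 1\<^sub>m m"
    using len diagC upper_triangularD[OF C(2)] Cc \<open>U * U = U\<close>
    by (intro upper_unitriangular_idempotent[OF carr(1)]) (auto simp: U_def intro!: upper_triangularI)
  have "D = 0\<^sub>m k k"
    using len diagC upper_triangularD[OF C(2)] Cc \<open>D * D = D\<close>
    by (intro upper_nilpotent_idempotent[OF carr(3)]) (auto simp: D_def intro!: upper_triangularI)
  \<comment> \<open>The two shears are inverse to each other. Multiplying the coordinate projection
    by \<open>?S\<close> on the left does nothing, and by \<open>?S'\<close> on the right it inserts
    \<open>Z\<close>.\<close>
  let ?S = "four_block_mat (1\<^sub>m m) (- Z) (0\<^sub>m k m) (1\<^sub>m k)"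
  let ?S' = "four_block_mat (1\<^sub>m m) Z (0\<^sub>m k m) (1\<^sub>m k)"
  note mult = mult_four_block_mat[OF one_carrier_mat _ zero_carrier_mat _ one_carrier_mat _ zero_carrier_mat]
  have Z: "Z \<in> carrier_mat m k" "- Z \<in> carrier_mat m k" using carr by simp_all
  have neg: "Z + - Z = 0\<^sub>m m k" "- 0\<^sub>m k k = (0\<^sub>m k k :: complex mat)"
    using Z by (auto intro!: eq_matI)
  have SS: "?S * ?S' = 1\<^sub>m n" "?S' * ?S = 1\<^sub>m n"
    using Z by (simp_all add: mult[OF Z(1) _ Z(2)] mult[OF Z(2) _ Z(1)] neg len[symmetric])
  have "?S * coord_proj m k = coord_proj m k"
    using Z by (simp add: coord_proj_def mult[OF Z(2) _ zero_carrier_mat])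
  moreover have "coord_proj m k * ?S' = C"
    using Z by (simp add: C_block coord_proj_def \<open>U = 1\<^sub>m m\<close> \<open>D = 0\<^sub>m k k\<close> mult[OF zero_carrier_mat _ Z(1)])
  ultimately have "C = ?S * coord_proj m k * ?S'" by simp
  then have "similar_mat C (coord_proj m k)"
    using SS Cc Z coord_proj_carrier[of m k] len
    by (intro similar_matI[of C "coord_proj m k" ?S ?S' n]) auto
  moreover have "similar_mat Q C" using C(1) unfolding similar_mat_def by blast
  ultimately show thesis using similar_mat_trans len that by blast
qed

section \<open>Block diagonality as commutation with a coordinate projection\<close>

lemma coord_proj_index:
  assumes "i < m + k" "j < m + k"
  shows "coord_proj m k $$ (i, j) = (if i = j \<and> i < m then 1 else 0)"
  using assms by (auto simp: coord_proj_def)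

lemma coord_proj_idempotent: "coord_proj m k * coord_proj m k = (coord_proj m k :: 'a::comm_semiring_1 mat)"
  unfolding coord_proj_def
  by (subst mult_four_block_mat[of _ m m _ k _ k _ _ m _ k]) simp_all

lemma mat_adjoint_coord_proj [simp]: "mat_adjoint (coord_proj m k :: complex mat) = coord_proj m k"
  using carrier_matD[OF coord_proj_carrier[of m k, where 'a = complex]]
  by (intro eq_matI) (auto simp: coord_proj_index)

text \<open>Left multiplication by the projection keeps the first \<open>m\<close> rows, right
  multiplication the first \<open>m\<close> columns. The results differ exactly in the two
  off-diagonal blocks.\<close>

lemma coord_proj_commute_iff:
  fixes H :: "'a::comm_ring_1 mat"
  assumes H: "H \<in> carrier_mat (m + k) (m + k)"
  shows "coord_proj m k * H = H * coord_proj m k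
    \<longleftrightarrow> (\<forall>i<m. \<forall>j<m + k. m \<le> j \<longrightarrow> H $$ (i, j) = 0 \<and> H $$ (j, i) = 0)"
proof -
  let ?J = "coord_proj m k :: 'a mat"
  note J = carrier_matD[OF coord_proj_carrier[of m k, where 'a = 'a]]
  have delta: "(\<Sum>l = 0..<m + k. (if i = l \<and> P then 1 else 0) * f l) = (if P then f i else 0)"
    if "i < m + k" for i P and f :: "nat \<Rightarrow> 'a"
    using that sum.delta[of "{0..<m + k}" i f] by (simp add: if_distrib[of "\<lambda>c. c * _"] cong: if_cong)
  have L: "(?J * H) $$ (i, j) = (if i < m then H $$ (i, j) else 0)"
    if "i < m + k" "j < m + k" for i j
  proof -
    have "(?J * H) $$ (i, j) = (\<Sum>l = 0..<m + k. (if i = l \<and> i < m then 1 else 0) * H $$ (l, j))"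
      using that H J by (auto simp: scalar_prod_def coord_proj_index intro!: sum.cong)
    then show ?thesis by (simp only: delta[OF that(1)])
  qed
  have R: "(H * ?J) $$ (i, j) = (if j < m then H $$ (i, j) else 0)"
    if "i < m + k" "j < m + k" for i j
  proof -
    have "(H * ?J) $$ (i, j) = (\<Sum>l = 0..<m + k. (if j = l \<and> j < m then 1 else 0) * H $$ (i, l))"
      using that H J by (auto simp: scalar_prod_def coord_proj_index intro!: sum.cong)
    then show ?thesis by (simp only: delta[OF that(2)])
  qed
  show ?thesis
  proof
    assume eq: "?J * H = H * ?J"
    have "(if i < m then H $$ (i, j) else 0) = (if j < m then H $$ (i, j) else 0)"
      if "i < m + k" "j < m + k" for i j
      using L[OF that] R[OF that] unfolding eq by simp
    from this[of i j for i j] show "\<forall>i<m. \<forall>j<m + k. m \<le> j \<longrightarrow> H $$ (i, j) = 0 \<and> H $$ (j, i) = 0"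
      by (metis not_less trans_less_add1)
  next
    assume off: "\<forall>i<m. \<forall>j<m + k. m \<le> j \<longrightarrow> H $$ (i, j) = 0 \<and> H $$ (j, i) = 0"
    show "?J * H = H * ?J"
    proof (rule eq_matI)
      fix i j assume "i < dim_row (H * ?J)" "j < dim_col (H * ?J)"
      then have "i < m + k" "j < m + k" using H J by simp_all
      then show "(?J * H) $$ (i, j) = (H * ?J) $$ (i, j)"
        using L[of i j] R[of i j] off by (cases "i < m"; cases "j < m") auto
    qed (use H J in simp_all)
  qed
qed

text \<open>With \<open>Q = P * J * M\<close> one has \<open>M * Q = J * M\<close>, so the two sides
  of the first equation are the congruence images under \<open>M\<close> of the two sides of the
  second. Congruence by an invertible matrix is injective. Both directions between idempotents and
  decompositions rest on this.\<close>

lemma congruence_intertwine_iff: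
  fixes M :: "complex mat"
  assumes c: "P \<in> carrier_mat n n" "M \<in> carrier_mat n n" "J \<in> carrier_mat n n" "W \<in> carrier_mat n n"
    and PM: "P * M = 1\<^sub>m n" and MP: "M * P = 1\<^sub>m n"
  shows "J * (M * W * mat_adjoint M) = (M * W * mat_adjoint M) * mat_adjoint J
    \<longleftrightarrow> (P * J * M) * W = W * mat_adjoint (P * J * M)"
proof -
  define Q where "Q = P * J * M"
  note assoc = assoc_mult_mat[of _ n n _ n _ n] and mc = mult_carrier_mat[of _ n n _ n]
  have c': "mat_adjoint P \<in> carrier_mat n n" "mat_adjoint M \<in> carrier_mat n n"
    "mat_adjoint J \<in> carrier_mat n n" "mat_adjoint Q \<in> carrier_mat n n" "Q \<in> carrier_mat n n"
    using c by (simp_all add: Q_def mc)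
  have cancel: "P * (M * Z) = Z" "M * (P * Z) = Z" if "Z \<in> carrier_mat n n" for Z
    using that c assoc[of P M Z] assoc[of M P Z] by (simp_all add: PM MP)
  have MQ: "M * Q = J * M"
    using c cancel by (simp add: Q_def assoc mc)
  have L: "J * (M * W * mat_adjoint M) = M * (Q * W) * mat_adjoint M"
  proof -
    have "J * (M * W * mat_adjoint M) = (J * M) * (W * mat_adjoint M)"
      using c c' by (simp add: assoc mc)
    also have "\<dots> = M * (Q * W) * mat_adjoint M"
      unfolding MQ[symmetric] using c c' by (simp add: assoc mc)
    finally show ?thesis .
  qed
  have R: "(M * W * mat_adjoint M) * mat_adjoint J = M * (W * mat_adjoint Q) * mat_adjoint M"
  proof -
    have "mat_adjoint M * mat_adjoint J = mat_adjoint Q * mat_adjoint M"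
      using mat_adjoint_mult[OF c(3,2)] mat_adjoint_mult[OF c(2) c'(5)] by (simp add: MQ)
    then show ?thesis using c c' by (simp add: assoc mc)
  qed
  have adj: "mat_adjoint M * mat_adjoint P = 1\<^sub>m n"
    using mat_adjoint_mult[OF c(1,2)] by (simp add: PM)
  have strip: "P * (M * Z * mat_adjoint M) * mat_adjoint P = Z" if "Z \<in> carrier_mat n n" for Z
    using that c c' cancel by (simp add: assoc mc adj)
  have "Q * W = W * mat_adjoint Q"
    if "M * (Q * W) * mat_adjoint M = M * (W * mat_adjoint Q) * mat_adjoint M"
    by (rule trans[OF strip[OF mc[OF c'(5) c(4)], symmetric, unfolded that] strip[OF mc[OF c(4) c'(4)]]])
  then have "M * (Q * W) * mat_adjoint M = M * (W * mat_adjoint Q) * mat_adjoint M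
      \<longleftrightarrow> Q * W = W * mat_adjoint Q" by auto
  then show ?thesis unfolding L R by (simp only: Q_def)
qed

subsection \<open>Congruences and direct sums of weights\<close>

lemma index_congruence:
  fixes X :: "complex mat"
  assumes "X \<in> carrier_mat m n" "W \<in> carrier_mat n n" "i < m" "j < m"
  shows "(X * W * mat_adjoint X) $$ (i, j)
       = (\<Sum>l = 0..<n. \<Sum>k = 0..<n. X $$ (i, k) * cnj (X $$ (j, l)) * W $$ (k, l))"
  using assms
  by (auto simp: scalar_prod_def sum_distrib_left sum_distrib_right mult_ac
      simp del: assoc_mult_mat intro!: sum.cong)

text \<open>Each entry of the congruence is a fixed linear combination of entries of
  \<open>W x\<close>. The factor \<open>c\<close> covers integrability (\<open>c = 1\<close>) and
  the moments (a power of \<open>x\<close>) at once.\<close>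

lemma set_integrable_congruence:
  fixes X :: "complex mat"
  assumes "\<And>i j. i < n \<Longrightarrow> j < n \<Longrightarrow> set_integrable M A (\<lambda>x. c x * W x $$ (i, j))"
    and W: "\<And>x. x \<in> A \<Longrightarrow> W x \<in> carrier_mat n n"
    and X: "X \<in> carrier_mat m n" and ij: "i < m" "j < m"
  shows "set_integrable M A (\<lambda>x. c x * (X * W x * mat_adjoint X) $$ (i, j))"
proof -
  have "set_integrable M A (\<lambda>x. \<Sum>l = 0..<n. \<Sum>k = 0..<n.
      X $$ (i, k) * cnj (X $$ (j, l)) * (c x * W x $$ (k, l)))"
  proof -
    have "set_integrable M A (\<lambda>x. X $$ (i, k) * cnj (X $$ (j, l)) * (c x * W x $$ (k, l)))"
      if "k < n" "l < n" for k l
      using assms(1)[OF that] by (rule set_integrable_mult_right)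
    then show ?thesis
      unfolding set_integrable_def scaleR_sum_right
      by (intro Bochner_Integration.integrable_sum) auto
  qed
  also have "?this \<longleftrightarrow> ?thesis"
    using index_congruence[OF X W ij]
    by (intro set_integrable_cong refl) (simp add: sum_distrib_left mult_ac)
  finally show ?thesis .
qed

lemma matrix_weight_carrier:
  "matrix_weight a b n W \<Longrightarrow> x \<in> einterval a b \<Longrightarrow> W x \<in> carrier_mat n n"
  by (simp add: matrix_weight_def pos_semidef_mat_def)

text \<open>Rectangular \<open>X\<close> is allowed so that a block of rows of an invertible matrix
  yields a weight of smaller size; the right inverse preserves definiteness.\<close>

lemma matrix_weight_congruence:
  assumes W: "matrix_weight a b n W" and "m \<ge> 1"
    and X: "X \<in> carrier_mat m n" and Y: "Y \<in> carrier_mat n m" "X * Y = 1\<^sub>m m"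
  shows "matrix_weight a b m (\<lambda>x. X * W x * mat_adjoint X)"
proof -
  note Wc = matrix_weight_carrier[OF W]
  have int: "set_integrable lebesgue (einterval a b) (\<lambda>x. 1 * (X * W x * mat_adjoint X) $$ (i, j))"
    if "i < m" "j < m" for i j
    using W by (intro set_integrable_congruence[OF _ Wc X that]) (auto simp: matrix_weight_def)
  have mom: "set_integrable lebesgue (einterval a b)
      (\<lambda>x. of_real (x ^ k) * (X * W x * mat_adjoint X) $$ (i, j))" if "i < m" "j < m" for i j k
    using W by (intro set_integrable_congruence[OF _ Wc X that]) (auto simp: matrix_weight_def)
  have "AE x in lebesgue. x \<in> einterval a b \<longrightarrow> pos_def_mat n (W x)"
    using W by (simp add: matrix_weight_def)
  then have "AE x in lebesgue. x \<in> einterval a b \<longrightarrow> pos_def_mat m (X * W x * mat_adjoint X)"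
    by eventually_elim (use pos_def_congruence[OF _ X Y] in blast)
  then show ?thesis
    using W int mom \<open>m \<ge> 1\<close> pos_semidef_congruence[OF _ X]
    unfolding matrix_weight_def by (auto simp del: assoc_mult_mat)
qed

section \<open>Positivity of block diagonal matrices and direct sums\<close>

lemma quadratic_form_block_diag:
  fixes A D :: "complex mat"
  assumes A: "A \<in> carrier_mat m m" and D: "D \<in> carrier_mat k k"
    and v: "v \<in> carrier_vec m" and w: "w \<in> carrier_vec k"
  shows "(four_block_mat A (0\<^sub>m m k) (0\<^sub>m k m) D *\<^sub>v (v @\<^sub>v w)) \<bullet>c (v @\<^sub>v w)
    = (A *\<^sub>v v) \<bullet>c v + (D *\<^sub>v w) \<bullet>c w"
proof -
  have "conjugate (v @\<^sub>v w) = conjugate v @\<^sub>v conjugate w"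
    by (rule eq_vecI) auto
  then show ?thesis
    using assms mult_mat_vec_split[OF assms]
      scalar_prod_append[OF mult_mat_vec_carrier[OF A v] mult_mat_vec_carrier[OF D w],
        of "conjugate v" "conjugate w"]
    by simp
qed

lemma mat_adjoint_block_diag:
  assumes "A \<in> carrier_mat m m" "D \<in> carrier_mat k k"
  shows "mat_adjoint (four_block_mat A (0\<^sub>m m k) (0\<^sub>m k m) D)
    = four_block_mat (mat_adjoint A) (0\<^sub>m m k) (0\<^sub>m k m) (mat_adjoint D)"
  using assms by (intro eq_matI) auto

lemma pos_semidef_block_diag:
  assumes "pos_semidef_mat m A" "pos_semidef_mat k D"
  shows "pos_semidef_mat (m + k) (four_block_mat A (0\<^sub>m m k) (0\<^sub>m k m) D)"
proof -
  have A: "A \<in> carrier_mat m m" and D: "D \<in> carrier_mat k k"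
    using assms by (simp_all add: pos_semidef_mat_def)
  have "0 \<le> (four_block_mat A (0\<^sub>m m k) (0\<^sub>m k m) D *\<^sub>v u) \<bullet>c u" if "u \<in> carrier_vec (m + k)" for u
    using quadratic_form_block_diag[OF A D, of "vec_first u m" "vec_last u k"] assms that
    by (simp add: pos_semidef_mat_def)
  then show ?thesis
    using assms A D by (simp add: pos_semidef_mat_def mat_adjoint_block_diag)
qed

lemma pos_def_imp_semidef: "pos_def_mat n A \<Longrightarrow> pos_semidef_mat n A"
  unfolding pos_def_mat_def pos_semidef_mat_def
proof (intro conjI ballI; (elim conjE)?)
  fix v :: "complex vec" assume A: "A \<in> carrier_mat n n" and v: "v \<in> carrier_vec n"
    and pos: "\<forall>v\<in>carrier_vec n. v \<noteq> 0\<^sub>v n \<longrightarrow> 0 < (A *\<^sub>v v) \<bullet>c v"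
  show "0 \<le> (A *\<^sub>v v) \<bullet>c v"
  proof (cases "v = 0\<^sub>v n")
    case True
    then show ?thesis using A by (simp add: scalar_prod_def)
  next
    case False
    then show ?thesis using pos v by (simp add: less_imp_le)
  qed
qed simp_all

lemma pos_def_block_diag:
  assumes A: "pos_def_mat m A" and D: "pos_def_mat k D"
  shows "pos_def_mat (m + k) (four_block_mat A (0\<^sub>m m k) (0\<^sub>m k m) D)"
proof -
  have Ac: "A \<in> carrier_mat m m" and Dc: "D \<in> carrier_mat k k"
    using assms by (simp_all add: pos_def_mat_def)
  have "0 < (four_block_mat A (0\<^sub>m m k) (0\<^sub>m k m) D *\<^sub>v u) \<bullet>c u"
    if u: "u \<in> carrier_vec (m + k)" "u \<noteq> 0\<^sub>v (m + k)" for u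
  proof -
    define v w where "v = vec_first u m" and "w = vec_last u k"
    have vw: "v \<in> carrier_vec m" "w \<in> carrier_vec k" "u = v @\<^sub>v w"
      using u by (simp_all add: v_def w_def)
    have "v \<noteq> 0\<^sub>v m \<or> w \<noteq> 0\<^sub>v k"
      using u(2) vw(3) by (auto intro!: eq_vecI)
    moreover have "0 \<le> (A *\<^sub>v v) \<bullet>c v" "0 \<le> (D *\<^sub>v w) \<bullet>c w"
      using assms[THEN pos_def_imp_semidef] vw(1,2) by (simp_all add: pos_semidef_mat_def)
    moreover have "v \<noteq> 0\<^sub>v m \<Longrightarrow> 0 < (A *\<^sub>v v) \<bullet>c v" "w \<noteq> 0\<^sub>v k \<Longrightarrow> 0 < (D *\<^sub>v w) \<bullet>c w"
      using assms vw(1,2) by (simp_all add: pos_def_mat_def)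
    ultimately have "0 < (A *\<^sub>v v) \<bullet>c v + (D *\<^sub>v w) \<bullet>c w"
      using add_pos_nonneg add_nonneg_pos by blast
    then show ?thesis using quadratic_form_block_diag[OF Ac Dc vw(1,2)] vw(3) by simp
  qed
  then show ?thesis
    using assms Ac Dc by (simp add: pos_def_mat_def mat_adjoint_block_diag)
qed

lemma direct_sum_weight_Cons:
  assumes "V x \<in> carrier_mat m m" "direct_sum_weight Vs x \<in> carrier_mat k k"
  shows "direct_sum_weight (V # Vs) x
    = four_block_mat (V x) (0\<^sub>m m k) (0\<^sub>m k m) (direct_sum_weight Vs x)"
  using assms by (simp add: direct_sum_weight_def Let_def)

lemma direct_sum_weight_singleton [simp]: "direct_sum_weight [V] x = V x"
  by (simp add: direct_sum_weight_def del: diag_block_mat.simps)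

text \<open>Equivalence requires both sides to be weights. This cannot be read off from a congruence
  valid almost everywhere, since semidefiniteness is demanded at every point.\<close>

lemma matrix_weight_direct_sum:
  assumes V: "matrix_weight a b m V" and U: "matrix_weight a b k U"
  shows "matrix_weight a b (m + k) (direct_sum_weight [V, U])"
proof -
  have eq: "direct_sum_weight [V, U] x = four_block_mat (V x) (0\<^sub>m m k) (0\<^sub>m k m) (U x)"
    if "x \<in> einterval a b" for x
    using matrix_weight_carrier[OF V that] matrix_weight_carrier[OF U that]
    by (simp add: direct_sum_weight_Cons)
  have int: "set_integrable lebesgue (einterval a b) (\<lambda>x. c x * direct_sum_weight [V, U] x $$ (i, j))"
    if ij: "i < m + k" "j < m + k"
      and c: "\<And>i j. i < m \<Longrightarrow> j < m \<Longrightarrow> set_integrable lebesgue (einterval a b) (\<lambda>x. c x * V x $$ (i, j))"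
        "\<And>i j. i < k \<Longrightarrow> j < k \<Longrightarrow> set_integrable lebesgue (einterval a b) (\<lambda>x. c x * U x $$ (i, j))"
    for i j and c :: "real \<Rightarrow> complex"
  proof -
    have "set_integrable lebesgue (einterval a b) (\<lambda>x. c x * direct_sum_weight [V, U] x $$ (i, j))
      \<longleftrightarrow> set_integrable lebesgue (einterval a b)
        (\<lambda>x. if i < m \<and> j < m then c x * V x $$ (i, j)
          else if m \<le> i \<and> m \<le> j then c x * U x $$ (i - m, j - m) else 0)"
      using ij carrier_matD[OF matrix_weight_carrier[OF V]] carrier_matD[OF matrix_weight_carrier[OF U]]
      by (intro set_integrable_cong) (auto simp: eq)
    also have "\<dots>"
    proof (cases "i < m \<and> j < m")
      case False
      have "set_integrable lebesgue (einterval a b) (\<lambda>x. 0 :: complex)"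
        by (simp add: set_integrable_def)
      then show ?thesis
        using c(2)[of "i - m" "j - m"] ij False by (cases "m \<le> i \<and> m \<le> j") auto
    qed (use c(1) in simp)
    finally show ?thesis .
  qed
  have "AE x in lebesgue. x \<in> einterval a b \<longrightarrow> pos_def_mat m (V x)"
    and "AE x in lebesgue. x \<in> einterval a b \<longrightarrow> pos_def_mat k (U x)"
    using V U by (simp_all add: matrix_weight_def)
  then have "AE x in lebesgue. x \<in> einterval a b \<longrightarrow> pos_def_mat (m + k) (direct_sum_weight [V, U] x)"
    by eventually_elim (auto simp: eq pos_def_block_diag)
  moreover have "set_integrable lebesgue (einterval a b) (\<lambda>x. direct_sum_weight [V, U] x $$ (i, j))"
    if "i < m + k" "j < m + k" for i j
    using int[of i j "\<lambda>_. 1"] that V U by (simp add: matrix_weight_def)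
  moreover have "set_integrable lebesgue (einterval a b) (\<lambda>x. of_real (x ^ l) * direct_sum_weight [V, U] x $$ (i, j))"
    if "i < m + k" "j < m + k" for i j l
    using int[of i j "\<lambda>x. of_real (x ^ l)"] that V U by (simp add: matrix_weight_def)
  ultimately show ?thesis
    using V U unfolding matrix_weight_def by (auto simp: eq pos_semidef_block_diag)
qed

section \<open>Almost everywhere on the interval and on the support\<close>

lemma AE_einterval_witness:
  assumes "a < b" "AE x in lebesgue. x \<in> einterval a b \<longrightarrow> P x"
  obtains x where "x \<in> einterval a b" "P x"
proof -
  \<comment> \<open>A nonempty open set is not negligible; this is where \<open>a < b\<close>
    enters.\<close>
  have "\<not> (AE x in lebesgue. x \<notin> einterval a b)"
    using open_not_negligible[of "einterval a b"] einterval_nonempty[OF assms(1)]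
    by (subst AE_iff_null_sets[symmetric]) (auto simp: negligible_iff_null_sets)
  moreover have "AE x in lebesgue. x \<notin> einterval a b" if "\<And>x. x \<in> einterval a b \<Longrightarrow> \<not> P x"
    using assms(2) by eventually_elim (use that in auto)
  ultimately show thesis using that by blast
qed

lemma pos_def_mat_nonzero:
  assumes "pos_def_mat n A" "n \<ge> 1"
  shows "A \<noteq> 0\<^sub>m n n"
proof
  assume "A = 0\<^sub>m n n"
  moreover have "0 < (A *\<^sub>v unit_vec n 0) \<bullet>c unit_vec n 0"
    using assms by (auto simp: pos_def_mat_def)
  ultimately show False by (auto simp: scalar_prod_def)
qed

text \<open>A positive definite matrix of size at least one is nonzero, so the support fills the
  interval up to a null set.\<close>

lemma AE_weight_support_iff:
  assumes W: "matrix_weight a b n W"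
  shows "(AE x in lebesgue. x \<in> weight_support a b n W \<longrightarrow> P x)
    \<longleftrightarrow> (AE x in lebesgue. x \<in> einterval a b \<longrightarrow> P x)"
proof
  have "AE x in lebesgue. x \<in> einterval a b \<longrightarrow> pos_def_mat n (W x)"
    using W by (simp add: matrix_weight_def)
  then have "AE x in lebesgue. x \<in> einterval a b \<longrightarrow> x \<in> weight_support a b n W"
  proof eventually_elim
    case (elim x)
    then show ?case
      using W pos_def_mat_nonzero[of n "W x"]
      by (auto simp: weight_support_def matrix_weight_def intro!: closure_subset[THEN subsetD])
  qed
  moreover assume "AE x in lebesgue. x \<in> weight_support a b n W \<longrightarrow> P x"
  ultimately show "AE x in lebesgue. x \<in> einterval a b \<longrightarrow> P x"
    by eventually_elim auto
next
  assume "AE x in lebesgue. x \<in> einterval a b \<longrightarrow> P x"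
  then show "AE x in lebesgue. x \<in> weight_support a b n W \<longrightarrow> P x"
    by eventually_elim (auto simp: weight_support_def)
qed

subsection \<open>Decompositions, idempotents and the real commutant\<close>

lemma decomposition_from_idempotent:
  assumes W: "matrix_weight a b n W"
    and Q: "Q \<in> carrier_mat n n" "Q * Q = Q" "Q \<noteq> 0\<^sub>m n n" "Q \<noteq> 1\<^sub>m n"
    and QW: "AE x in lebesgue. x \<in> einterval a b \<longrightarrow> Q * W x = W x * mat_adjoint Q"
  shows "\<exists>Ws. (\<forall>V \<in> set Ws. \<exists>m<n. matrix_weight a b m V) \<and>
              weight_equivalent a b n W (direct_sum_weight Ws)"
proof -
  obtain m k where n: "n = m + k" and "similar_mat Q (coord_proj m k)"
    using idempotent_similar_coord_proj[OF Q(1,2)] .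
  then obtain P M where "similar_mat_wit Q (coord_proj m k) P M"
    by (auto simp: similar_mat_def)
  note w = similar_mat_witD2[OF Q(1) this]
  note PM = w(1) and MP = w(2) and Q_eq = w(3) and P = w(6) and M = w(7)
  \<comment> \<open>An empty block would make \<open>Q\<close> zero or, below, the identity. Both
    blocks being nonempty, both summands have size less than \<open>n\<close>.\<close>
  have "m \<noteq> 0"
  proof
    assume "m = 0"
    then have "coord_proj m k = (0\<^sub>m n n :: complex mat)"
      by (auto simp: n coord_proj_def intro!: eq_matI)
    then show False using Q(3) Q_eq P M by simp
  qed
  have "k \<noteq> 0"
  proof
    assume "k = 0"
    then have "coord_proj m k = (1\<^sub>m n :: complex mat)"
      by (auto simp: n coord_proj_def intro!: eq_matI)
    then show False using Q(4) Q_eq P PM by simp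
  qed
  \<comment> \<open>\<open>X1\<close> and \<open>X2\<close> are the upper and lower rows of
    \<open>M\<close>, \<open>Y1\<close> and \<open>Y2\<close> the matching columns of its inverse.
    The diagonal blocks of \<open>M * P = 1\<^sub>m n\<close> make each \<open>Y\<close> a right
    inverse of its \<open>X\<close>.\<close>
  define X1 Y1 where "X1 = mat m n (\<lambda>(i, j). M $$ (i, j))" and "Y1 = mat n m (\<lambda>(i, j). P $$ (i, j))"
  define X2 Y2 where "X2 = mat k n (\<lambda>(i, j). M $$ (i + m, j))" and "Y2 = mat n k (\<lambda>(i, j). P $$ (i, j + m))"
  have X: "X1 \<in> carrier_mat m n" "X2 \<in> carrier_mat k n" and Y: "Y1 \<in> carrier_mat n m" "Y2 \<in> carrier_mat n k"
    by (simp_all add: X1_def X2_def Y1_def Y2_def)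
  have MP_ent: "(\<Sum>l = 0..<n. M $$ (i, l) * P $$ (l, j)) = (if i = j then 1 else 0)"
    if "i < n" "j < n" for i j
    using that M P arg_cong[OF MP, of "\<lambda>A. A $$ (i, j)"] by (simp add: scalar_prod_def)
  have XY: "X1 * Y1 = 1\<^sub>m m" "X2 * Y2 = 1\<^sub>m k"
    using MP_ent n by (auto intro!: eq_matI simp: X1_def X2_def Y1_def Y2_def scalar_prod_def)
  \<comment> \<open>These are the diagonal blocks of \<open>M W M^*\<close>. They are weights on the
    whole interval, even at points where the off-diagonal blocks do not vanish.\<close>
  define V1 V2 where "V1 = (\<lambda>x. X1 * W x * mat_adjoint X1)" and "V2 = (\<lambda>x. X2 * W x * mat_adjoint X2)"
  have V1: "matrix_weight a b m V1" and V2: "matrix_weight a b k V2"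
    unfolding V1_def V2_def
    using matrix_weight_congruence[OF W _ X(1) Y(1) XY(1)] matrix_weight_congruence[OF W _ X(2) Y(2) XY(2)]
      \<open>m \<noteq> 0\<close> \<open>k \<noteq> 0\<close> by simp_all
  have "AE x in lebesgue. x \<in> einterval a b \<longrightarrow>
      direct_sum_weight [V1, V2] x = M * W x * mat_adjoint M"
    using QW
  proof eventually_elim
    case (elim x)
    show ?case
    proof
      assume x: "x \<in> einterval a b"
      note Wx = matrix_weight_carrier[OF W x]
      define H where "H = M * W x * mat_adjoint M"
      have H: "H \<in> carrier_mat (m + k) (m + k)"
        unfolding H_def using M Wx n by (intro mult_carrier_mat[of _ "m + k" n]) auto
      have J: "coord_proj m k \<in> carrier_mat n n" by (simp add: n)
      \<comment> \<open>The intertwining relation for \<open>Q\<close> at \<open>x\<close>, carried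
        over by \<open>M\<close>; the projection is its own adjoint, so it becomes plain
        commutation.\<close>
      have "coord_proj m k * H = H * coord_proj m k"
        using congruence_intertwine_iff[OF P M J Wx PM MP] elim x
        by (simp add: H_def Q_eq[symmetric] del: assoc_mult_mat)
      then have off: "\<forall>i<m. \<forall>j<m + k. m \<le> j \<longrightarrow> H $$ (i, j) = 0 \<and> H $$ (j, i) = 0"
        by (simp only: coord_proj_commute_iff[OF H])
      have V1x: "V1 x $$ (i, j) = H $$ (i, j)" if "i < m" "j < m" for i j
        using that n index_congruence[OF X(1) Wx that] index_congruence[OF M Wx, of i j]
        by (simp add: V1_def H_def X1_def del: assoc_mult_mat index_mult_mat(1))
      have V2x: "V2 x $$ (i, j) = H $$ (i + m, j + m)" if "i < k" "j < k" for i j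
        using that n index_congruence[OF X(2) Wx that] index_congruence[OF M Wx, of "i + m" "j + m"]
        by (simp add: V2_def H_def X2_def del: assoc_mult_mat index_mult_mat(1))
      note c = matrix_weight_carrier[OF V1 x] matrix_weight_carrier[OF V2 x]
      have "direct_sum_weight [V1, V2] x = four_block_mat (V1 x) (0\<^sub>m m k) (0\<^sub>m k m) (V2 x)"
        using c by (simp add: direct_sum_weight_Cons)
      also have "\<dots> = H"
        using carrier_matD[OF c(1)] carrier_matD[OF c(2)] carrier_matD[OF H] off
        by (intro eq_matI) (auto simp: V1x V2x)
      finally show "direct_sum_weight [V1, V2] x = M * W x * mat_adjoint M"
        by (simp add: H_def)
    qed
  qed
  moreover have "invertible_mat M"
    using M P PM MP unfolding invertible_mat_def inverts_mat_def by auto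
  ultimately have "weight_equivalent a b n W (direct_sum_weight [V1, V2])"
    using W M matrix_weight_direct_sum[OF V1 V2] unfolding weight_equivalent_def n by blast
  moreover have "\<forall>V \<in> set [V1, V2]. \<exists>m<n. matrix_weight a b m V"
    using V1 V2 n \<open>m \<noteq> 0\<close> \<open>k \<noteq> 0\<close> exI[of _ m] exI[of _ k] by simp
  ultimately show ?thesis by blast
qed

text \<open>The projection onto the first summand commutes with the direct sum; all other summands
  are lumped into one block of size \<open>k\<close>. Conjugating it back by \<open>M\<close> gives
  \<open>Q\<close>.\<close>

lemma idempotent_from_decomposition:
  assumes "a < b" and Ws: "\<forall>V \<in> set Ws. \<exists>m<n. matrix_weight a b m V"
    and eqv: "weight_equivalent a b n W (direct_sum_weight Ws)"
  shows "\<exists>Q \<in> carrier_mat n n. Q * Q = Q \<and> Q \<noteq> 0\<^sub>m n n \<and> Q \<noteq> 1\<^sub>m n \<and>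
              (AE x in lebesgue. x \<in> einterval a b \<longrightarrow> Q * W x = W x * mat_adjoint Q)"
proof -
  have W: "matrix_weight a b n W" and D: "matrix_weight a b n (direct_sum_weight Ws)"
    using eqv by (simp_all add: weight_equivalent_def)
  obtain M where M: "M \<in> carrier_mat n n" "invertible_mat M"
    and DW: "AE x in lebesgue. x \<in> einterval a b \<longrightarrow> direct_sum_weight Ws x = M * W x * mat_adjoint M"
    using eqv by (auto simp: weight_equivalent_def)
  obtain P where MP: "M * P = 1\<^sub>m n" and "P * M = 1\<^sub>m (dim_row P)"
    using M by (auto simp: invertible_mat_def inverts_mat_def)
  \<comment> \<open>The inverse comes without a size: \<open>M * P\<close> fixes its number of
    columns, \<open>P * M\<close> its number of rows.\<close>
  moreover have P: "P \<in> carrier_mat n n"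
    using M(1) arg_cong[OF MP, of dim_col] arg_cong[OF \<open>P * M = 1\<^sub>m (dim_row P)\<close>, of dim_col]
    by (auto intro: carrier_matI)
  ultimately have PM: "P * M = 1\<^sub>m n" by simp
  have "n \<ge> 1" using W by (simp add: matrix_weight_def)
  obtain x0 where x0: "x0 \<in> einterval a b" using einterval_nonempty[OF \<open>a < b\<close>] by blast
  \<comment> \<open>The empty direct sum has size zero, whereas \<open>n \<ge> 1\<close>.\<close>
  have "Ws \<noteq> []"
    using matrix_weight_carrier[OF D x0] \<open>n \<ge> 1\<close> by (auto simp: direct_sum_weight_def)
  then obtain V Vs where Ws_eq: "Ws = V # Vs" by (cases Ws) auto
  then obtain m where "m < n" and V: "matrix_weight a b m V" using Ws by auto
  define k where "k = n - m"
  have n: "n = m + k" and "k \<ge> 1" using \<open>m < n\<close> by (simp_all add: k_def)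
  have "m \<ge> 1" using V by (simp add: matrix_weight_def)
  let ?J = "coord_proj m k :: complex mat"
  have J: "?J \<in> carrier_mat n n" by (simp add: n)
  have block: "?J * direct_sum_weight Ws x = direct_sum_weight Ws x * ?J" if x: "x \<in> einterval a b" for x
  proof -
    note Vx = matrix_weight_carrier[OF V x] and Dx = matrix_weight_carrier[OF D x]
    let ?B = "direct_sum_weight Vs x"
    \<comment> \<open>The size of the tail is what the first block leaves of the total; its
      individual summands are never examined.\<close>
    have B: "?B \<in> carrier_mat k k"
      using Dx Vx by (auto simp: n Ws_eq direct_sum_weight_def Let_def intro!: carrier_matI)
    have "direct_sum_weight Ws x = four_block_mat (V x) (0\<^sub>m m k) (0\<^sub>m k m) ?B"
      unfolding Ws_eq using Vx B by (rule direct_sum_weight_Cons)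
    then show ?thesis
      using Dx Vx B unfolding n by (subst coord_proj_commute_iff) auto
  qed
  define Q where "Q = P * ?J * M"
  note assoc = assoc_mult_mat[of _ n n _ n _ n] and mc = mult_carrier_mat[of _ n n _ n]
  have Q: "Q \<in> carrier_mat n n" using P M J by (simp add: Q_def mc)
  \<comment> \<open>Undoing the conjugation reduces \<open>Q \<noteq> 0\<^sub>m n n\<close> and
    \<open>Q \<noteq> 1\<^sub>m n\<close> to the projection, whose diagonal entries at
    \<open>0\<close> and \<open>m\<close> are 1 and 0.\<close>
  have J_eq: "M * Q * P = ?J"
  proof -
    have "M * Q * P = (M * P) * (?J * (M * P))"
      using P M(1) J unfolding Q_def by (simp add: assoc mc del: assoc_mult_mat)
    then show ?thesis using J by (simp add: MP)
  qed
  have "Q * Q = Q"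
  proof -
    have "Q * Q = P * (?J * ((M * P) * (?J * M)))"
      using P M(1) J unfolding Q_def by (simp add: assoc mc del: assoc_mult_mat)
    also have "\<dots> = P * (?J * ?J * M)"
      using P M(1) J by (simp add: MP assoc mc del: assoc_mult_mat)
    also have "\<dots> = Q"
      using P M(1) J by (simp add: coord_proj_idempotent Q_def assoc mc del: assoc_mult_mat)
    finally show ?thesis .
  qed
  moreover have "Q \<noteq> 0\<^sub>m n n"
  proof
    assume "Q = 0\<^sub>m n n"
    then have "?J = 0\<^sub>m n n" using J_eq M(1) P by simp
    then have "?J $$ (0, 0) = 0" using \<open>n \<ge> 1\<close> by simp
    then show False using \<open>m \<ge> 1\<close> by (simp add: coord_proj_index)
  qed
  moreover have "Q \<noteq> 1\<^sub>m n"
  proof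
    assume "Q = 1\<^sub>m n"
    then have "?J = 1\<^sub>m n" using J_eq M(1) MP by simp
    then have "?J $$ (m, m) = 1" using \<open>m < n\<close> by simp
    then show False using \<open>k \<ge> 1\<close> by (simp add: coord_proj_index)
  qed
  moreover have "AE x in lebesgue. x \<in> einterval a b \<longrightarrow> Q * W x = W x * mat_adjoint Q"
    using DW
  proof eventually_elim
    case (elim x)
    show ?case
    proof
      assume x: "x \<in> einterval a b"
      show "Q * W x = W x * mat_adjoint Q"
        using congruence_intertwine_iff[OF P M(1) J matrix_weight_carrier[OF W x] PM MP] block[OF x] elim x
        by (simp add: Q_def del: assoc_mult_mat)
    qed
  qed
  ultimately show ?thesis using Q by blast
qed

lemma real_scalar_mats_subset_commutant:
  assumes "\<And>x. x \<in> S \<Longrightarrow> W x \<in> carrier_mat n n"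
  shows "real_scalar_mats n \<subseteq> real_commutant n S W"
proof
  fix T assume "T \<in> real_scalar_mats n"
  then obtain r where T: "T = complex_of_real r \<cdot>\<^sub>m 1\<^sub>m n" by (auto simp: real_scalar_mats_def)
  have "T * W x = W x * mat_adjoint T" if "x \<in> S" for x
    using assms[OF that]
    by (simp add: T mat_adjoint_smult mult_smult_assoc_mat[of _ n n _ n] mult_smult_distrib[of _ n n _ n])
  then show "T \<in> real_commutant n S W" by (auto simp: real_commutant_def T)
qed

lemma idempotent_not_real_scalar:
  assumes "Q * Q = Q" "Q \<noteq> 0\<^sub>m n n" "Q \<noteq> 1\<^sub>m n"
  shows "Q \<notin> real_scalar_mats n"
proof
  assume "Q \<in> real_scalar_mats n"
  then obtain r where Qr: "Q = complex_of_real r \<cdot>\<^sub>m 1\<^sub>m n" by (auto simp: real_scalar_mats_def)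
  have "n \<noteq> 0" using assms(2) Qr by (auto intro!: eq_matI)
  have "Q * Q = complex_of_real (r * r) \<cdot>\<^sub>m 1\<^sub>m n"
    unfolding Qr by (auto intro!: eq_matI)
  then have "Q $$ (0, 0) = complex_of_real (r * r)"
    using \<open>n \<noteq> 0\<close> assms(1) by simp
  then have "complex_of_real r = complex_of_real (r * r)" using \<open>n \<noteq> 0\<close> by (simp add: Qr)
  then have "r = 0 \<or> r = 1" by (simp flip: of_real_mult)
  then show False using assms(2,3) Qr by (auto intro!: eq_matI)
qed

theorem theorem2p8:
  fixes a b :: ereal and N :: nat and W :: "real \<Rightarrow> complex mat" and S :: "real set"
  assumes "a < b"
    and "matrix_weight a b N W"
    and "S = weight_support a b N W"
  shows "((\<exists>Ws. (\<forall>V \<in> set Ws. \<exists>m<N. matrix_weight a b m V) \<and>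
              weight_equivalent a b N W (direct_sum_weight Ws))
          \<longleftrightarrow>
          (\<exists>Q \<in> carrier_mat N N. Q * Q = Q \<and> Q \<noteq> 0\<^sub>m N N \<and> Q \<noteq> 1\<^sub>m N \<and>
              (AE x in lebesgue. x \<in> einterval a b \<longrightarrow> Q * W x = W x * mat_adjoint Q)))
       \<and>
         ((\<exists>Q \<in> carrier_mat N N. Q * Q = Q \<and> Q \<noteq> 0\<^sub>m N N \<and> Q \<noteq> 1\<^sub>m N \<and>
              (AE x in lebesgue. x \<in> einterval a b \<longrightarrow> Q * W x = W x * mat_adjoint Q))
          \<longleftrightarrow>
          real_scalar_mats N \<subset> real_commutant N S W)"
proof (intro conjI iffI)
  assume "\<exists>Ws. (\<forall>V \<in> set Ws. \<exists>m<N. matrix_weight a b m V) \<and>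
              weight_equivalent a b N W (direct_sum_weight Ws)"
  then show "\<exists>Q \<in> carrier_mat N N. Q * Q = Q \<and> Q \<noteq> 0\<^sub>m N N \<and> Q \<noteq> 1\<^sub>m N \<and>
              (AE x in lebesgue. x \<in> einterval a b \<longrightarrow> Q * W x = W x * mat_adjoint Q)"
    using idempotent_from_decomposition[OF assms(1)] by blast
next
  assume "\<exists>Q \<in> carrier_mat N N. Q * Q = Q \<and> Q \<noteq> 0\<^sub>m N N \<and> Q \<noteq> 1\<^sub>m N \<and>
              (AE x in lebesgue. x \<in> einterval a b \<longrightarrow> Q * W x = W x * mat_adjoint Q)"
  then show "\<exists>Ws. (\<forall>V \<in> set Ws. \<exists>m<N. matrix_weight a b m V) \<and>
              weight_equivalent a b N W (direct_sum_weight Ws)"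
    using decomposition_from_idempotent[OF assms(2)] by blast
next
  assume "\<exists>Q \<in> carrier_mat N N. Q * Q = Q \<and> Q \<noteq> 0\<^sub>m N N \<and> Q \<noteq> 1\<^sub>m N \<and>
              (AE x in lebesgue. x \<in> einterval a b \<longrightarrow> Q * W x = W x * mat_adjoint Q)"
  then obtain Q where Q: "Q \<in> carrier_mat N N" "Q * Q = Q" "Q \<noteq> 0\<^sub>m N N" "Q \<noteq> 1\<^sub>m N"
    and QW: "AE x in lebesgue. x \<in> einterval a b \<longrightarrow> Q * W x = W x * mat_adjoint Q"
    by blast
  have "Q \<in> real_commutant N S W"
    using Q(1) QW AE_weight_support_iff[OF assms(2)] by (simp add: real_commutant_def assms(3))
  moreover have "real_scalar_mats N \<subseteq> real_commutant N S W"
    using matrix_weight_carrier[OF assms(2)]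
    by (intro real_scalar_mats_subset_commutant) (simp add: assms(3) weight_support_def)
  ultimately show "real_scalar_mats N \<subset> real_commutant N S W"
    using idempotent_not_real_scalar[OF Q(2-4)] by blast
next
  assume "real_scalar_mats N \<subset> real_commutant N S W"
  then obtain T where T: "T \<in> carrier_mat N N" "T \<notin> real_scalar_mats N"
    and "AE x in lebesgue. x \<in> S \<longrightarrow> T * W x = W x * mat_adjoint T"
    by (auto simp: real_commutant_def)
  then have TW: "AE x in lebesgue. x \<in> einterval a b \<longrightarrow> T * W x = W x * mat_adjoint T"
    using AE_weight_support_iff[OF assms(2)] by (simp add: assms(3))
  moreover have "AE x in lebesgue. x \<in> einterval a b \<longrightarrow> pos_def_mat N (W x)"
    using assms(2) by (simp add: matrix_weight_def)
  ultimately have "AE x in lebesgue. x \<in> einterval a b \<longrightarrow>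
      pos_def_mat N (W x) \<and> T * W x = W x * mat_adjoint T"
    by eventually_elim simp
  \<comment> \<open>A single point where definiteness and the intertwining relation hold together is
    all that the spectral argument needs.\<close>
  from AE_einterval_witness[OF assms(1) this]
  obtain x where x: "pos_def_mat N (W x)" "T * W x = W x * mat_adjoint T"
    by blast
  \<comment> \<open>\<open>Q\<close> is a real polynomial in \<open>T\<close>, so \<open>sym\<close>
    holds for every \<open>U\<close> that \<open>T\<close> intertwines and not just for the value of
    \<open>W\<close> at the chosen point.\<close>
  obtain Q where Q: "Q \<in> carrier_mat N N" "Q * Q = Q" "Q \<noteq> 0\<^sub>m N N" "Q \<noteq> 1\<^sub>m N"
    and sym: "\<And>U. U \<in> carrier_mat N N \<Longrightarrow> T * U = U * mat_adjoint T \<Longrightarrow> Q * U = U * mat_adjoint Q"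
    using spectral_idempotent[OF x(1) T(1) x(2) T(2)] by blast
  have "AE x in lebesgue. x \<in> einterval a b \<longrightarrow> Q * W x = W x * mat_adjoint Q"
    using TW by eventually_elim (use sym matrix_weight_carrier[OF assms(2)] in blast)
  then show "\<exists>Q \<in> carrier_mat N N. Q * Q = Q \<and> Q \<noteq> 0\<^sub>m N N \<and> Q \<noteq> 1\<^sub>m N \<and>
              (AE x in lebesgue. x \<in> einterval a b \<longrightarrow> Q * W x = W x * mat_adjoint Q)"
    using Q by blast
qed

end
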